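(* Assume Assumption A1 (stated in the context). Let $h,r,M$ be positive constants, put $\lambda=h^{2m}$, and suppose $c_K^2\sqrt{M}\,r\,h^{-1/2}A(h)\le1/2$. Then $$\sup_{f\in H^m(1)}P_f\Big(\Big\|\widehat f_{n,\lambda}-f-\Big(\frac1n\sum_{i=1}^n\epsilon_iK_{X_i}-\mathcal{P}_\lambda f\Big)\Big\|\ge\gamma_n(M,r)\Big)\le2\exp(-Mnhr^2),$$ where $\gamma_n(M,r)=c_K^2\sqrt{M}\,r\,h^{-1/2}A(h)\,\delta_n(M,r)$ and $\delta_n(M,r)=2h^m+c_K\big(\sqrt{2M}\,r+(nh)^{-1/2}\big)$.
   Context: Fix an integer $m\ge1$ and $\mathbb{I}=[0,1]$. $S^m(\mathbb{I})$ is the Sobolev space of $f\in L^2(\mathbb{I})$ such that $f^{(j)}$ is absolutely continuous for $j=0,\dots,m-1$ and $\int_0^1|f^{(m)}(x)|^2dx<\infty$. Data $(Y_i,X_i)$, $i=1,\dots,n$, are i.i.d. copies of $(Y,X)$ with $Y=f(X)+\epsilon$, where $X\sim\mathrm{Unif}[0,1]$, $\epsilon\sim N(0,1)$ is independent of $X$, and $f\in S^m(\mathbb{I})$; $P_f$ denotes probability when $f$ is the true regression function, and $\epsilon_i=Y_i-f(X_i)$. Let $J(f,g)=\int_0^1f^{(m)}(x)g^{(m)}(x)dx$ and $V(f,g)=E\{f(X)g(X)\}$. For $\lambda>0$ let $\langle f,g\rangle=V(f,g)+\lambda J(f,g)$ with norm $\|\cdot\|$; $(S^m(\mathbb{I}),\langle\cdot,\cdot\rangle)$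 is a reproducing kernel Hilbert space with kernel $K$, $K_x=K(x,\cdot)$, $\langle K_x,f\rangle=f(x)$. $\mathcal{P}_\lambda$ is the self-adjoint operator on $S^m(\mathbb{I})$ with $\langle f,\mathcal{P}_\lambda g\rangle=\lambda J(f,g)$ for all $f,g$. The smoothing spline estimator is $\widehat f_{n,\lambda}=\arg\max_{f\in S^m(\mathbb{I})}\{-\frac{1}{2n}\sum_{i=1}^n(Y_i-f(X_i))^2-\frac{\lambda}{2}J(f,f)\}$. Assumption A1: there exist $\varphi_\nu\in S^m(\mathbb{I})$, $\nu\ge1$, with $\sup_{\nu}\|\varphi_\nu\|_{\sup}<\infty$, and a nondecreasing sequence $\rho_\nu$ with $\rho_\nu/(c_\rho\nu)^{2m}\to1$ for some constant $c_\rho>0$, such that $V(\varphi_\mu,\varphi_\nu)=\delta_{\mu\nu}$, $J(\varphi_\mu,\varphi_\nu)=\rho_\mu\delta_{\mu\nu}$, and every $g\in S^m(\mathbb{I})$ satisfies $g=\sum_\nu V(g,\varphi_\nu)\varphi_\nu$ with convergence in $\|\cdot\|$. With $h=\lambda^{1/(2m)}$, let $c_K=\sup_{x\in\mathbb{I}}\sqrt{hK(x,x)}$ (finite under A1), $H^m(1)=\{f\in S^m(\mathbb{I}):J(f,f)\le1\}$, $\mathcal{G}=\{g\in S^m(\mathbb{I}):\|g\|_{\sup}\le1,\ J(g,g)\le c_K^{-2}h^{-2m+1}\}$, and let $c_0>0$ be a constant such that $\log N(\varepsilon,\mathcal{G},\|\cdot\|_{\sup})\le c_0h^{-(2m-1)/(2m)}\varepsilon^{-1/m}$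 for all $\varepsilon>0$, where $N$ is the $\varepsilon$-packing number. Let $\tau=\sqrt{\log1.5}$, $\Psi(r)=\int_0^r\sqrt{\log(1+\exp(x^{-1/m}))}\,dx$, $$A(h,\varepsilon)=\frac{32\sqrt6}{\tau}c_K^{-1}c_0^mh^{-(2m-1)/2}\Psi\Big(\tfrac12c_Kc_0^{-m}h^{(2m-1)/2}\varepsilon\Big)+\frac{20\sqrt6\,\varepsilon}{\tau}\sqrt{\log\Big(1+\exp\big(2c_0(c_Kh^{(2m-1)/2}\varepsilon)^{-1/m}\big)\Big)},$$ and $A(h)=A(h,2)$. *)

theory Defs
  imports "HOL-Probability.Probability"
begin

definition abs_cont_on :: "real \<Rightarrow> real \<Rightarrow> (real \<Rightarrow> real) \<Rightarrow> bool" where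
  "abs_cont_on a b f \<longleftrightarrow>
     (\<forall>e>0. \<exists>d>0. \<forall>(k::nat) (u::nat \<Rightarrow> real) (v::nat \<Rightarrow> real).
        (\<forall>i<k. a \<le> u i \<and> u i \<le> v i \<and> v i \<le> b) \<and>
        (\<forall>i<k. \<forall>j<k. i \<noteq> j \<longrightarrow> v i \<le> u j \<or> v j \<le> u i) \<and>
        (\<Sum>i<k. v i - u i) < d
        \<longrightarrow> (\<Sum>i<k. \<bar>f (v i) - f (u i)\<bar>) < e)"

definition sob_chain :: "nat \<Rightarrow> (real \<Rightarrow> real) \<Rightarrow> (nat \<Rightarrow> real \<Rightarrow> real) \<Rightarrow> bool" where
  "sob_chain m f D \<longleftrightarrow>
     (\<forall>x\<in>{0..1}. D 0 x = f x) \<and>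
     (\<forall>j<m. abs_cont_on 0 1 (D j) \<and>
        (AE x in lborel. x \<in> {0<..<1} \<longrightarrow> (D j has_real_derivative D (Suc j) x) (at x))) \<and>
     set_borel_measurable lborel {0..1} (D m) \<and>
     set_integrable lborel {0..1} (\<lambda>x. (D m x)\<^sup>2)"

definition sobolev :: "nat \<Rightarrow> (real \<Rightarrow> real) set" where
  "sobolev m = {f. \<exists>D. sob_chain m f D}"

text \<open>The m-th (weak) derivative f^(m) (a.e. unique on [0,1]).\<close>
definition sob_deriv :: "nat \<Rightarrow> (real \<Rightarrow> real) \<Rightarrow> real \<Rightarrow> real" where
  "sob_deriv m f = (SOME D. sob_chain m f D) m"

definition Jm :: "nat \<Rightarrow> (real \<Rightarrow> real) \<Rightarrow> (real \<Rightarrow> real) \<Rightarrow> real" where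
  "Jm m f g = (LINT x:{0..1}|lborel. sob_deriv m f x * sob_deriv m g x)"

definition Vf :: "(real \<Rightarrow> real) \<Rightarrow> (real \<Rightarrow> real) \<Rightarrow> real" where
  "Vf f g = integral\<^sup>L (uniform_measure lborel {0..1}) (\<lambda>x. f x * g x)"

definition sinner :: "nat \<Rightarrow> real \<Rightarrow> (real \<Rightarrow> real) \<Rightarrow> (real \<Rightarrow> real) \<Rightarrow> real" where
  "sinner m lam f g = Vf f g + lam * Jm m f g"

definition snorm :: "nat \<Rightarrow> real \<Rightarrow> (real \<Rightarrow> real) \<Rightarrow> real" where
  "snorm m lam f = sqrt (sinner m lam f f)"

definition assumption_A1 :: "nat \<Rightarrow> real \<Rightarrow> bool" where
  "assumption_A1 m lam \<longleftrightarrow>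
     (\<exists>(\<phi>::nat \<Rightarrow> real \<Rightarrow> real) (\<rho>::nat \<Rightarrow> real) (c\<rho>::real).
        (\<forall>\<nu>\<ge>1. \<phi> \<nu> \<in> sobolev m) \<and>
        (\<exists>B. \<forall>\<nu>\<ge>1. \<forall>x\<in>{0..1}. \<bar>\<phi> \<nu> x\<bar> \<le> B) \<and>
        (\<forall>\<mu> \<nu>. 1 \<le> \<mu> \<longrightarrow> \<mu> \<le> \<nu> \<longrightarrow> \<rho> \<mu> \<le> \<rho> \<nu>) \<and>
        c\<rho> > 0 \<and>
        ((\<lambda>\<nu>. \<rho> \<nu> / (c\<rho> * real \<nu>) ^ (2 * m)) \<longlonglongrightarrow> 1) \<and>
        (\<forall>\<mu>\<ge>1. \<forall>\<nu>\<ge>1. Vf (\<phi> \<mu>) (\<phi> \<nu>) = (if \<mu> = \<nu> then 1 else 0)) \<and>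
        (\<forall>\<mu>\<ge>1. \<forall>\<nu>\<ge>1. Jm m (\<phi> \<mu>) (\<phi> \<nu>) = (if \<mu> = \<nu> then \<rho> \<mu> else 0)) \<and>
        (\<forall>g\<in>sobolev m.
           (\<lambda>N. snorm m lam (\<lambda>x. g x - (\<Sum>\<nu>=1..N. Vf g (\<phi> \<nu>) * \<phi> \<nu> x))) \<longlonglongrightarrow> 0))"

definition is_repr_kernel :: "nat \<Rightarrow> real \<Rightarrow> (real \<Rightarrow> real \<Rightarrow> real) \<Rightarrow> bool" where
  "is_repr_kernel m lam K \<longleftrightarrow>
     (\<forall>x\<in>{0..1}. K x \<in> sobolev m \<and> (\<forall>f\<in>sobolev m. sinner m lam (K x) f = f x))"

definition is_P_op :: "nat \<Rightarrow> real \<Rightarrow> ((real \<Rightarrow> real) \<Rightarrow> (real \<Rightarrow> real)) \<Rightarrow> bool" where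
  "is_P_op m lam P \<longleftrightarrow>
     (\<forall>g\<in>sobolev m. P g \<in> sobolev m \<and> (\<forall>f\<in>sobolev m. sinner m lam f (P g) = lam * Jm m f g))"

definition c_K :: "real \<Rightarrow> (real \<Rightarrow> real \<Rightarrow> real) \<Rightarrow> real" where
  "c_K h K = (SUP x\<in>{0..1}. sqrt (h * K x x))"

definition sup_norm :: "(real \<Rightarrow> real) \<Rightarrow> real" where
  "sup_norm f = (SUP x\<in>{0..1}. \<bar>f x\<bar>)"

definition packing_number :: "real \<Rightarrow> (real \<Rightarrow> real) set \<Rightarrow> enat" where
  "packing_number e G = (SUP P\<in>{P. P \<subseteq> G \<and> finite P \<and>
       (\<forall>f\<in>P. \<forall>g\<in>P. f \<noteq> g \<longrightarrow> sup_norm (\<lambda>x. f x - g x) > e)}. enat (card P))"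

definition G_class :: "nat \<Rightarrow> real \<Rightarrow> real \<Rightarrow> (real \<Rightarrow> real) set" where
  "G_class m h cK = {g \<in> sobolev m. sup_norm g \<le> 1 \<and>
       Jm m g g \<le> cK powr (-2) * h powr (- 2 * real m + 1)}"

definition Psi :: "nat \<Rightarrow> real \<Rightarrow> real" where
  "Psi m r = integral {0..r} (\<lambda>x. sqrt (ln (1 + exp (x powr (- 1 / real m)))))"

definition tau :: real where "tau = sqrt (ln (3/2))"

definition A_fun :: "nat \<Rightarrow> real \<Rightarrow> real \<Rightarrow> real \<Rightarrow> real \<Rightarrow> real" where
  "A_fun m c0 cK h e =
     32 * sqrt 6 / tau * (1 / cK) * c0 ^ m * h powr (- (2 * real m - 1) / 2) *
       Psi m (1/2 * cK * (1 / c0 ^ m) * h powr ((2 * real m - 1) / 2) * e)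
     + 20 * sqrt 6 * e / tau *
       sqrt (ln (1 + exp (2 * c0 * (cK * h powr ((2 * real m - 1) / 2) * e) powr (- 1 / real m))))"

text \<open>Law of one observation (X, eps): X ~ Unif[0,1], eps ~ N(0,1) independent; the sample
  of size n is the n-fold product.\<close>
definition sample_space :: "nat \<Rightarrow> (nat \<Rightarrow> real \<times> real) measure" where
  "sample_space n = PiM {..<n} (\<lambda>_. uniform_measure lborel {0..1} \<Otimes>\<^sub>M density lborel std_normal_density)"

definition pen_lik :: "nat \<Rightarrow> real \<Rightarrow> nat \<Rightarrow> (nat \<Rightarrow> real) \<Rightarrow> (nat \<Rightarrow> real) \<Rightarrow> (real \<Rightarrow> real) \<Rightarrow> real" where
  "pen_lik m lam n X Y f = - (1 / (2 * real n)) * (\<Sum>i<n. (Y i - f (X i))\<^sup>2) - lam / 2 * Jm m f f"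

definition is_spline_est :: "nat \<Rightarrow> real \<Rightarrow> nat \<Rightarrow> (nat \<Rightarrow> real) \<Rightarrow> (nat \<Rightarrow> real) \<Rightarrow> (real \<Rightarrow> real) \<Rightarrow> bool" where
  "is_spline_est m lam n X Y fh \<longleftrightarrow> fh \<in> sobolev m \<and>
     (\<forall>g\<in>sobolev m. pen_lik m lam n X Y g \<le> pen_lik m lam n X Y fh)"

end

theory Submission
  imports Defs
begin

text \<open>
  Put \<open>g = \<close> estimator \<open>- f\<close> and let \<open>R\<close> be the remainder to be bounded.  The first order condition of the penalised
  least squares problem says that \<open>R\<close> represents the form
  \<open>u \<mapsto> V(g, u) - (1/n) \<Sum>\<^sub>i g(X\<^sub>i) u(X\<^sub>i)\<close>, so \<open>|R| \<le> |Z| |g|\<close>, where \<open>Z\<close> is the centred empirical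
  average of the rank-one operators \<open>K_X \<otimes> K_X\<close>.  Since \<open>|g| \<le> |R| + |noise| + h^m\<close>, small \<open>|Z|\<close>
  turns this into a bound for \<open>|R|\<close>.

  No chaining is needed: \<open>A(h) \<ge> 32\<close> makes the claim weak enough for Hoeffding bounds in Hilbert
  space, with the Hilbert-Schmidt norm for \<open>Z\<close> and the RKHS norm for the noise.
  Both follow from the fact that \<open>cosh |S|\<close> of a sum \<open>S\<close> of independent centred vectors grows by a
  bounded factor with each summand (Pinelis).  Coordinates in the eigenbasis are truncated to
  finitely many, uniformly in the truncation level.
\<close>

section \<open>Hoeffding bounds for sums of independent vectors\<close>

text \<open>The Hilbert-Schmidt norm of the rank-one operator at x is \<open>K x x\<close>, at most
  \<open>c_K^2 / h\<close>, so a centred summand has norm at most \<open>2 * c_K^2 / h\<close>. Let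
  \<kappa> be the factor in front of \<open>\<delta>_n\<close> and
  \<open>t = M * n * h * r^2\<close>. Hoeffding at level \<open>\<kappa> / 4\<close> has exponent
  \<open>t * A(h)^2 / 256\<close>, which \<open>A(h) \<ge> 32\<close> turns into at least
  \<open>4 * t\<close>; the noise at level \<open>2 * c_K * sqrt (2 * M) * r\<close> has exponent
  \<open>4 * t\<close> as well. The surplus over t pays for the union of the two events.

  Two obstacles shape the rest. Functions are total on the reals but constrained on the unit
  interval only, so \<open>Vf\<close> is not bilinear on \<open>sobolev m\<close>; the work is done
  with a form that sees only the unit interval, and results are transferred at the boundary of the
  argument. Moreover the set in the theorem quantifies over minimisers, so it is covered by a
  measurable event, built from countable unions over truncation levels.\<close>

lemma power_convex_comb:
  fixes x y w :: real
  assumes "0 \<le> x" "0 \<le> y" "0 \<le> w" "w \<le> 1"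
  shows "((1 - w) * x + w * y) ^ k \<le> (1 - w) * x ^ k + w * y ^ k"
proof (cases "even k")
  case True
  then show ?thesis
    using convex_onD[OF convex_power_even[OF True], of w x y] assms by simp
next
  case False
  then show ?thesis
    using convex_onD[OF convex_power_odd[OF False], of w x y] assms by simp
qed

text \<open>The series of \<open>cosh (sqrt z)\<close> is the sum of \<open>z^k / (2k)!\<close>. Its
  coefficients are nonnegative, so convexity on z \<ge> 0 holds term by term. The point is that
  \<open>cosh\<close> of a norm is convex in the squared norm.\<close>

lemma cosh_sqrt_convex_comb:
  fixes x y w :: real
  assumes "0 \<le> x" "0 \<le> y" "0 \<le> w" "w \<le> 1"
  shows "cosh (sqrt ((1 - w) * x + w * y)) \<le> (1 - w) * cosh (sqrt x) + w * cosh (sqrt y)"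
proof (rule sums_le[OF _ cosh_converges sums_add[OF sums_mult[OF cosh_converges] sums_mult[OF cosh_converges]]])
  fix n :: nat
  have sqrt_pow: "sqrt z ^ (2 * k) = z ^ k" if "0 \<le> z" for z k
    using that by (simp add: power_mult)
  have nn: "0 \<le> (1 - w) * x + w * y" using assms by simp
  have le: "((1 - w) * x + w * y) ^ k / fact (2 * k) \<le> ((1 - w) * x ^ k + w * y ^ k) / fact (2 * k)" for k
    by (intro divide_right_mono power_convex_comb assms) simp
  show "(if even n then sqrt ((1 - w) * x + w * y) ^ n /\<^sub>R fact n else 0)
      \<le> (1 - w) * (if even n then sqrt x ^ n /\<^sub>R fact n else 0)
        + w * (if even n then sqrt y ^ n /\<^sub>R fact n else 0)"
  proof (cases "even n")
    case True
    then obtain k where "n = 2 * k" by (elim evenE)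
    then show ?thesis
      using le[of k] assms
      by (simp only: sqrt_pow nn True if_True dvd_triv_left) (simp add: add_divide_distrib divide_inverse algebra_simps)
  qed simp
qed

lemma L2_set_add_squared:
  "(L2_set (\<lambda>i. s i + x i) F)\<^sup>2 = (L2_set s F)\<^sup>2 + (L2_set x F)\<^sup>2 + 2 * (\<Sum>i\<in>F. s i * x i)"
  unfolding L2_set_def
  by (simp add: real_sqrt_pow2 sum_nonneg) (simp add: power2_sum sum.distrib sum_distrib_left mult.assoc)

lemma abs_sum_mult_le_L2_set: "\<bar>\<Sum>i\<in>F. s i * x i\<bar> \<le> L2_set s F * L2_set x F"
  using order_trans[OF sum_abs[of "\<lambda>i. s i * x i" F], of "L2_set s F * L2_set x F"] L2_set_mult_ineq[of s x F]
  by (simp add: abs_mult)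

text \<open>As a function of the inner product of \<open>s\<close> and \<open>x\<close>, the left-hand side is convex; the right-hand
  side is its chord between the two extreme values \<open>cosh (|s| - |x|)\<close> and \<open>cosh (|s| + |x|)\<close>.\<close>
lemma cosh_L2_set_add_le:
  "cosh (L2_set (\<lambda>i. s i + x i) F)
    \<le> cosh (L2_set s F) * cosh (L2_set x F)
      + (\<Sum>i\<in>F. s i * x i) * (sinh (L2_set s F) / L2_set s F) * (sinh (L2_set x F) / L2_set x F)"
proof -
  define a c u where "a = L2_set s F" and "c = L2_set x F" and "u = (\<Sum>i\<in>F. s i * x i)"
  have ac: "0 \<le> a" "0 \<le> c" by (simp_all add: a_def c_def L2_set_nonneg)
  have u: "\<bar>u\<bar> \<le> a * c" unfolding a_def c_def u_def by (rule abs_sum_mult_le_L2_set)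
  have sq: "L2_set (\<lambda>i. s i + x i) F = sqrt (a\<^sup>2 + c\<^sup>2 + 2 * u)"
    unfolding a_def c_def u_def L2_set_add_squared[symmetric] by (simp add: L2_set_nonneg)
  show ?thesis
  \<comment> \<open>For a vanishing norm the quotient \<open>sinh 0 / 0\<close> has the default
    value \<open>0\<close> instead of its limit \<open>1\<close>. This is harmless, as
    Cauchy-Schwarz forces \<open>u = 0\<close>.\<close>
  proof (cases "a * c = 0")
    case True
    then have "u = 0" "a = 0 \<or> c = 0" using u by auto
    then show ?thesis unfolding sq using ac
      by (auto simp: a_def[symmetric] c_def[symmetric] u_def[symmetric])
  next
    case False
    then have pos: "a > 0" "c > 0" using ac by auto
    \<comment> \<open>The weight, affine in \<open>u\<close>, that places the squared norm of the
      sum on the segment from \<open>(a - c)\<^sup>2\<close> to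
      \<open>(a + c)\<^sup>2\<close>.\<close>
    define w where "w = (u / (a * c) + 1) / 2"
    have "\<bar>u / (a * c)\<bar> \<le> 1" using u pos by (simp add: abs_mult divide_le_eq)
    then have w: "0 \<le> w" "w \<le> 1" unfolding w_def abs_le_iff by (simp_all del: abs_divide)
    have e: "a\<^sup>2 + c\<^sup>2 + 2 * u = (1 - w) * (a - c)\<^sup>2 + w * (a + c)\<^sup>2"
      using pos unfolding w_def by (simp add: field_simps power2_eq_square)
    have "cosh (sqrt (a\<^sup>2 + c\<^sup>2 + 2 * u)) \<le> (1 - w) * cosh (sqrt ((a - c)\<^sup>2)) + w * cosh (sqrt ((a + c)\<^sup>2))"
      unfolding e by (rule cosh_sqrt_convex_comb) (use w in auto)
    also have "\<dots> = (1 - w) * cosh (a - c) + w * cosh (a + c)"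
      using pos by (simp add: abs_if)
    also have "\<dots> = cosh a * cosh c + u * (sinh a / a) * (sinh c / c)"
      using pos unfolding w_def by (simp add: cosh_add cosh_diff field_simps)
    finally show ?thesis unfolding sq by (simp add: a_def c_def u_def)
  qed
qed

text \<open>Converts the factor \<open>cosh c + sinh c - c\<close> of the next estimate, which
  equals \<open>exp c - c\<close>, into a sub-Gaussian one. Up to \<open>1\<close> the quadratic
  Taylor bound of \<open>exp\<close> suffices, and beyond it c \<le>
  \<open>c\<^sup>2\<close>.\<close>

lemma exp_minus_self_le:
  fixes c :: real
  assumes "0 \<le> c"
  shows "exp c - c \<le> exp (c\<^sup>2)"
proof (cases "c \<le> 1")
  case True
  then show ?thesis using exp_bound[OF assms True] exp_ge_add_one_self[of "c\<^sup>2"] by linarith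
next
  case False
  then have "exp c \<le> exp (c\<^sup>2)" by (simp add: power2_eq_square)
  then show ?thesis using assms by linarith
qed

lemma sinh_ge_self:
  fixes c :: real
  assumes "0 \<le> c"
  shows "c \<le> sinh c"
proof -
  have "(\<lambda>x. sinh x - x) 0 \<le> (\<lambda>x. sinh x - x) c"
  proof (rule DERIV_nonneg_imp_nondecreasing[OF assms])
    fix x :: real
    show "\<exists>y. ((\<lambda>x. sinh x - x) has_real_derivative y) (at x) \<and> 0 \<le> y"
      by (rule exI[of _ "cosh x - 1"]) (auto intro!: derivative_eq_intros simp: cosh_real_ge_1)
  qed
  then show ?thesis by simp
qed

lemma sinh_le_cosh: "sinh (x::real) \<le> cosh x"
  by (simp add: sinh_def cosh_def)

text \<open>Isolates the part of the cross term that is linear in \<open>x\<close>, because a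
  centred expectation annihilates it; its coefficient is that of the gradient of \<open>cosh\<close>
  of the norm at \<open>s\<close>. The excess carries the factor \<open>sinh c / c - 1\<close>,
  which is nonnegative, so Cauchy-Schwarz bounds it by \<open>cosh a * (sinh c - c)\<close>.\<close>

lemma cosh_L2_set_add_le_linear:
  "cosh (L2_set (\<lambda>i. s i + x i) F)
    \<le> cosh (L2_set s F) * exp ((L2_set x F)\<^sup>2) + (sinh (L2_set s F) / L2_set s F) * (\<Sum>i\<in>F. s i * x i)"
proof -
  define a c u where "a = L2_set s F" and "c = L2_set x F" and "u = (\<Sum>i\<in>F. s i * x i)"
  have ac: "0 \<le> a" "0 \<le> c" by (simp_all add: a_def c_def L2_set_nonneg)
  have u: "u \<le> a * c" using abs_sum_mult_le_L2_set[of s x F] by (simp add: a_def c_def u_def)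
  have "u * (sinh a / a) * (sinh c / c) \<le> cosh a * (sinh c - c) + (sinh a / a) * u"
  proof (cases "a * c = 0")
    case True
    then have "u = 0" using abs_sum_mult_le_L2_set[of s x F] by (auto simp: a_def c_def u_def)
    then show ?thesis using sinh_ge_self[of c] ac by (simp add: cosh_real_nonneg)
  next
    case False
    then have pos: "a > 0" "c > 0" using ac by auto
    have "u * (sinh a / a) * (sinh c / c - 1) \<le> (a * c) * (sinh a / a) * (sinh c / c - 1)"
      using sinh_ge_self[of c] pos
      by (intro mult_right_mono u) (auto simp: field_simps)
    also have "\<dots> = sinh a * (sinh c - c)" using pos by (simp add: field_simps)
    also have "\<dots> \<le> cosh a * (sinh c - c)"
      using sinh_ge_self[of c] pos by (intro mult_right_mono sinh_le_cosh) auto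
    finally have "u * (sinh a / a) * (sinh c / c) - u * (sinh a / a) * 1 \<le> cosh a * (sinh c - c)"
      by (simp only: right_diff_distrib)
    then show ?thesis by (simp only: mult.commute[of u] mult_1_right diff_le_eq add.commute)
  qed
  moreover have "cosh a * (cosh c + sinh c - c) \<le> cosh a * exp (c\<^sup>2)"
    using exp_minus_self_le[OF ac(2)]
    by (intro mult_left_mono) (auto simp: cosh_plus_sinh cosh_real_nonneg)
  ultimately show ?thesis
    using cosh_L2_set_add_le[of s x F] unfolding a_def[symmetric] c_def[symmetric] u_def[symmetric]
    by (simp add: algebra_simps)
qed

section \<open>Exponential moments of a single summand\<close>

lemma borel_measurable_cosh [measurable]: "(cosh :: real \<Rightarrow> real) \<in> borel_measurable borel"
  by (intro borel_measurable_continuous_onI continuous_intros)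

text \<open>Here \<open>s\<close> stands for the sum of the other, frozen summands. The linear term
  of the majorant integrates to zero, and the growth factor depends on the norm bound
  \<open>a\<close> alone, not on the number of coordinates.\<close>

lemma (in prob_space) nn_integral_cosh_centred_le:
  assumes F: "finite F"
    and meas: "\<And>i. i \<in> F \<Longrightarrow> (\<lambda>z. \<xi> z i) \<in> borel_measurable M"
    and int: "\<And>i. i \<in> F \<Longrightarrow> integrable M (\<lambda>z. \<xi> z i)"
    and zero: "\<And>i. i \<in> F \<Longrightarrow> (\<integral>z. \<xi> z i \<partial>M) = 0"
    and bd: "\<And>z. L2_set (\<xi> z) F \<le> a"
  shows "(\<integral>\<^sup>+z. ennreal (cosh (L2_set (\<lambda>i. s i + \<xi> z i) F)) \<partial>M)
           \<le> ennreal (exp (a\<^sup>2)) * ennreal (cosh (L2_set s F))"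
proof -
  define \<kappa> where "\<kappa> = sinh (L2_set s F) / L2_set s F"
  define C where "C = cosh (L2_set s F) * exp (a\<^sup>2)"
  define g where "g = (\<lambda>z. C + \<kappa> * (\<Sum>i\<in>F. s i * \<xi> z i))"
  have le: "cosh (L2_set (\<lambda>i. s i + \<xi> z i) F) \<le> g z" for z
  proof -
    have "(L2_set (\<xi> z) F)\<^sup>2 \<le> a\<^sup>2" using bd[of z] by (intro power_mono L2_set_nonneg)
    then have "cosh (L2_set s F) * exp ((L2_set (\<xi> z) F)\<^sup>2) \<le> C"
      unfolding C_def by (intro mult_left_mono) (auto simp: cosh_real_nonneg)
    then show ?thesis
      using cosh_L2_set_add_le_linear[of s "\<xi> z" F] unfolding g_def \<kappa>_def by linarith
  qed
  have gi: "integrable M g" unfolding g_def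
    using int by (intro Bochner_Integration.integrable_add integrable_const integrable_mult_right
        Bochner_Integration.integrable_sum) auto
  have "(\<integral>z. g z \<partial>M) = C" unfolding g_def using int zero F
    by (subst Bochner_Integration.integral_add)
       (auto simp: prob_space Bochner_Integration.integral_sum)
  \<comment> \<open>The majorant dominates a hyperbolic cosine, hence is nonnegative, and its two
    integrals agree.\<close>
  moreover have "(\<integral>\<^sup>+z. ennreal (g z) \<partial>M) = ennreal (\<integral>z. g z \<partial>M)"
    using le by (intro nn_integral_eq_integral gi AE_I2) (meson cosh_real_nonneg order_trans)
  ultimately have "(\<integral>\<^sup>+z. ennreal (g z) \<partial>M) = ennreal C" by simp
  moreover have "(\<integral>\<^sup>+z. ennreal (cosh (L2_set (\<lambda>i. s i + \<xi> z i) F)) \<partial>M) \<le> (\<integral>\<^sup>+z. ennreal (g z) \<partial>M)"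
    by (intro nn_integral_mono ennreal_leI le)
  ultimately show ?thesis by (simp add: C_def ennreal_mult[symmetric] cosh_real_nonneg mult.commute)
qed

lemma nn_integral_cosh_std_normal:
  "(\<integral>\<^sup>+e. ennreal (cosh (e * c)) \<partial>density lborel (\<lambda>x. ennreal (std_normal_density x))) = ennreal (exp (c\<^sup>2 / 2))"
proof -
  \<comment> \<open>Completing the square: exponential tilting shifts the mean of the Gaussian to
    \<open>d\<close>.\<close>
  have tilt: "std_normal_density x * exp (x * d) = exp (d\<^sup>2 / 2) * normal_density d 1 x" for x d :: real
    unfolding normal_density_def
    by (simp add: exp_add[symmetric] field_simps power2_eq_square)
  have mgf: "(\<integral>\<^sup>+x. ennreal (std_normal_density x * exp (x * d)) \<partial>lborel) = ennreal (exp (d\<^sup>2 / 2))" for d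
  proof -
    have "(\<integral>\<^sup>+x. ennreal (normal_density d 1 x) \<partial>lborel) = 1"
      using prob_space.emeasure_space_1[OF prob_space_normal_density[of 1 d]]
      by (simp add: emeasure_density)
    then show ?thesis unfolding tilt by (simp add: ennreal_mult nn_integral_cmult)
  qed
  have "(\<integral>\<^sup>+e. ennreal (cosh (e * c)) \<partial>density lborel (\<lambda>x. ennreal (std_normal_density x)))
      = (\<integral>\<^sup>+x. ennreal (std_normal_density x * cosh (x * c)) \<partial>lborel)"
    by (subst nn_integral_density) (auto simp: ennreal_mult cosh_real_nonneg)
  also have "\<dots> = (\<integral>\<^sup>+x. ennreal (1/2) * (ennreal (std_normal_density x * exp (x * c)) + ennreal (std_normal_density x * exp (x * (- c)))) \<partial>lborel)"
  proof (intro nn_integral_cong)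
    fix x :: real
    have "std_normal_density x * cosh (x * c)
        = 1/2 * (std_normal_density x * exp (x * c) + std_normal_density x * exp (x * (- c)))"
      by (simp add: cosh_def field_simps)
    then show "ennreal (std_normal_density x * cosh (x * c))
        = ennreal (1/2) * (ennreal (std_normal_density x * exp (x * c)) + ennreal (std_normal_density x * exp (x * (- c))))"
      by (simp only: ennreal_mult' ennreal_plus mult_nonneg_nonneg normal_density_nonneg exp_ge_zero)
  qed
  also have "\<dots> = ennreal (1/2) * ((\<integral>\<^sup>+x. ennreal (std_normal_density x * exp (x * c)) \<partial>lborel)
      + (\<integral>\<^sup>+x. ennreal (std_normal_density x * exp (x * (- c))) \<partial>lborel))"
    by (subst nn_integral_cmult, measurable, subst nn_integral_add, measurable)
  also have "\<dots> = ennreal (1/2) * (ennreal (exp (c\<^sup>2/2)) + ennreal (exp (c\<^sup>2/2)))"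
    by (simp only: mgf power2_minus)
  also have "\<dots> = ennreal (1/2 * (exp (c\<^sup>2/2) + exp (c\<^sup>2/2)))"
    by (subst ennreal_mult, simp, simp, subst ennreal_plus) simp_all
  finally show ?thesis by simp
qed

lemma nn_integral_std_normal_reflect:
  assumes [measurable]: "g \<in> borel_measurable borel"
  shows "(\<integral>\<^sup>+e. g (- e) \<partial>density lborel (\<lambda>x. ennreal (std_normal_density x)))
       = (\<integral>\<^sup>+e. g e \<partial>density lborel (\<lambda>x. ennreal (std_normal_density x)))"
proof -
  have "(\<integral>\<^sup>+e. ennreal (std_normal_density e) * g e \<partial>lborel)
      = (\<integral>\<^sup>+e. ennreal (std_normal_density (- e)) * g (- e) \<partial>lborel)"
    using nn_integral_real_affine[of "\<lambda>e. ennreal (std_normal_density e) * g e" "-1" 0] by simp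
  then show ?thesis
    by (simp add: nn_integral_density std_normal_density_def)
qed

text \<open>The Gaussian factor is unbounded, so the estimate for bounded summands does not apply;
  symmetry replaces it. The cross term is odd in \<open>e\<close>, so it cancels exactly when the
  bounds for \<open>e\<close> and \<open>-e\<close> are added, leaving \<open>cosh\<close> of the
  norm of \<open>s\<close> times \<open>cosh (e * L2_set k F)\<close>, whose Gaussian mean is
  explicit.\<close>

lemma nn_integral_cosh_normal_multiple_le:
  assumes F: "finite F"
  shows "(\<integral>\<^sup>+e. ennreal (cosh (L2_set (\<lambda>i. s i + e * k i) F)) \<partial>density lborel (\<lambda>x. ennreal (std_normal_density x)))
           \<le> ennreal (exp ((L2_set k F)\<^sup>2 / 2)) * ennreal (cosh (L2_set s F))"
proof -
  let ?N = "density lborel (\<lambda>x. ennreal (std_normal_density x))"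
  let ?g = "\<lambda>e. ennreal (cosh (L2_set (\<lambda>i. s i + e * k i) F))"
  have [measurable]: "?g \<in> borel_measurable borel"
    unfolding L2_set_def by measurable
  have [measurable]: "(\<lambda>e. ?g (- e)) \<in> borel_measurable borel"
    unfolding L2_set_def by measurable
  have norm: "L2_set (\<lambda>i. e * k i) F = \<bar>e\<bar> * L2_set k F" for e
    using L2_set_right_distrib[of "\<bar>e\<bar>" k F] unfolding L2_set_def by (simp add: power_mult_distrib)
  have pair: "?g e + ?g (- e) \<le> ennreal (2 * cosh (L2_set s F)) * ennreal (cosh (e * L2_set k F))" for e
  proof -
    have even: "cosh (\<bar>e\<bar> * c) = cosh (e * c)" for c :: real by (cases "e \<ge> 0") auto
    have "cosh (L2_set (\<lambda>i. s i + e * k i) F) + cosh (L2_set (\<lambda>i. s i + (- e) * k i) F)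
        \<le> 2 * cosh (L2_set s F) * cosh (e * L2_set k F)"
      using cosh_L2_set_add_le[of s "\<lambda>i. e * k i" F] cosh_L2_set_add_le[of s "\<lambda>i. (- e) * k i" F]
      unfolding norm by (simp add: even sum_negf algebra_simps)
    then show ?thesis
      by (simp add: ennreal_mult[symmetric] ennreal_plus[symmetric] cosh_real_nonneg del: ennreal_plus)
  qed
  have "2 * (\<integral>\<^sup>+e. ?g e \<partial>?N) = (\<integral>\<^sup>+e. ?g e \<partial>?N) + (\<integral>\<^sup>+e. ?g (- e) \<partial>?N)"
    by (subst nn_integral_std_normal_reflect[of ?g]) (measurable, simp add: mult_2)
  also have "\<dots> = (\<integral>\<^sup>+e. ?g e + ?g (- e) \<partial>?N)"
    by (rule nn_integral_add[symmetric]) measurable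
  also have "\<dots> \<le> (\<integral>\<^sup>+e. ennreal (2 * cosh (L2_set s F)) * ennreal (cosh (e * L2_set k F)) \<partial>?N)"
    by (intro nn_integral_mono pair)
  also have "\<dots> = ennreal (2 * cosh (L2_set s F)) * ennreal (exp ((L2_set k F)\<^sup>2 / 2))"
    by (subst nn_integral_cmult) (auto simp: nn_integral_cosh_std_normal)
  also have "\<dots> = 2 * (ennreal (exp ((L2_set k F)\<^sup>2 / 2)) * ennreal (cosh (L2_set s F)))"
    by (simp add: ennreal_mult cosh_real_nonneg ac_simps)
  finally show ?thesis
    by (simp add: ennreal_mult_le_mult_iff)
qed

text \<open>A supermartingale argument: the last observation is integrated out with the partial sum
  of the earlier ones in the role of \<open>s\<close>. This is why \<open>step\<close> is required
  for every shift \<open>s\<close>.\<close>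

lemma nn_integral_PiM_sum_le:
  fixes \<xi> :: "'z \<Rightarrow> 'i \<Rightarrow> real" and C :: ennreal
  assumes N: "prob_space N"
    and meas: "\<And>n::nat. (\<lambda>\<omega>. \<Phi> (\<lambda>i. \<Sum>j<n. \<xi> (\<omega> j) i)) \<in> borel_measurable (PiM {..<n} (\<lambda>_. N))"
    and step: "\<And>s. (\<integral>\<^sup>+z. \<Phi> (\<lambda>i. s i + \<xi> z i) \<partial>N) \<le> C * \<Phi> s"
  shows "(\<integral>\<^sup>+\<omega>. \<Phi> (\<lambda>i. \<Sum>j<n. \<xi> (\<omega> j) i) \<partial>PiM {..<(n::nat)} (\<lambda>_. N)) \<le> C ^ n * \<Phi> (\<lambda>_. 0)"
proof (induction n)
  case 0
  interpret prob_space N by fact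
  interpret product_sigma_finite "\<lambda>_::nat. N" by unfold_locales
  show ?case by (simp add: nn_integral_count_space_finite PiM_empty)
next
  case (Suc n)
  interpret prob_space N by fact
  interpret product_sigma_finite "\<lambda>_::nat. N" by unfold_locales
  have "(\<integral>\<^sup>+\<omega>. \<Phi> (\<lambda>i. \<Sum>j<Suc n. \<xi> (\<omega> j) i) \<partial>PiM {..<Suc n} (\<lambda>_. N))
      = (\<integral>\<^sup>+\<omega>. (\<integral>\<^sup>+z. \<Phi> (\<lambda>i. \<Sum>j<Suc n. \<xi> (fun_upd \<omega> n z j) i) \<partial>N) \<partial>PiM {..<n} (\<lambda>_. N))"
    unfolding lessThan_Suc using meas[of "Suc n"]
    by (intro product_nn_integral_insert) (auto simp: lessThan_Suc)
  also have "\<dots> = (\<integral>\<^sup>+\<omega>. (\<integral>\<^sup>+z. \<Phi> (\<lambda>i. (\<Sum>j<n. \<xi> (\<omega> j) i) + \<xi> z i) \<partial>N) \<partial>PiM {..<n} (\<lambda>_. N))"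
  proof -
    have "(\<Sum>j<Suc n. \<xi> (fun_upd \<omega> n z j) i) = (\<Sum>j<n. \<xi> (\<omega> j) i) + \<xi> z i" for \<omega> z i
      by (auto intro!: sum.cong)
    then show ?thesis by presburger
  qed
  also have "\<dots> \<le> (\<integral>\<^sup>+\<omega>. C * \<Phi> (\<lambda>i. \<Sum>j<n. \<xi> (\<omega> j) i) \<partial>PiM {..<n} (\<lambda>_. N))"
    by (intro nn_integral_mono step)
  also have "\<dots> = C * (\<integral>\<^sup>+\<omega>. \<Phi> (\<lambda>i. \<Sum>j<n. \<xi> (\<omega> j) i) \<partial>PiM {..<n} (\<lambda>_. N))"
    by (rule nn_integral_cmult[OF meas])
  also have "\<dots> \<le> C * (C ^ n * \<Phi> (\<lambda>_. 0))"
    by (intro mult_left_mono Suc) simp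
  finally show ?case by (simp add: mult.assoc)
qed

text \<open>Markov's inequality with \<open>exp u \<le> 2 * cosh u\<close>. Since \<open>C\<close>
  does not depend on \<open>N\<close> and the events increase, the bound passes to their countable
  union.\<close>

lemma (in prob_space) measure_exceeds_le_of_cosh:
  fixes q :: "nat \<Rightarrow> 'a \<Rightarrow> real"
  assumes meas [measurable]: "\<And>N. q N \<in> borel_measurable M"
    and mono: "\<And>N \<omega>. q N \<omega> \<le> q (Suc N) \<omega>"
    and mom: "\<And>N. (\<integral>\<^sup>+\<omega>. ennreal (cosh (\<theta> * q N \<omega>)) \<partial>M) \<le> ennreal C"
    and C: "0 \<le> C" and \<theta>: "0 \<le> \<theta>"
  shows "measure M {\<omega>\<in>space M. \<exists>N. q N \<omega> > y} \<le> 2 * C * exp (- (\<theta> * y))"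
proof -
  define A where "A N = {\<omega>\<in>space M. q N \<omega> > y}" for N
  have A[measurable]: "A N \<in> sets M" for N unfolding A_def by measurable
  have "incseq A" unfolding A_def using mono by (intro incseq_SucI) (auto intro: less_le_trans)
  then have lim: "(\<lambda>N. measure M (A N)) \<longlonglongrightarrow> measure M (\<Union>N. A N)"
    by (intro finite_Lim_measure_incseq) auto
  have bd: "measure M (A N) \<le> 2 * C * exp (- (\<theta> * y))" for N
  proof -
    let ?u = "\<lambda>\<omega>. ennreal (cosh (\<theta> * q N \<omega>))"
    have "A N \<subseteq> {\<omega>\<in>space M. 1 \<le> ennreal (2 * exp (- (\<theta> * y))) * ?u \<omega>}"
    proof
      fix \<omega> assume "\<omega> \<in> A N"
      then have w: "\<omega> \<in> space M" "y < q N \<omega>" by (auto simp: A_def)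
      then have "exp (\<theta> * y) \<le> exp (\<theta> * q N \<omega>)" using \<theta> by (simp add: mult_left_mono)
      also have "\<dots> \<le> 2 * cosh (\<theta> * q N \<omega>)" by (simp add: cosh_def)
      finally have "exp (- (\<theta> * y)) * exp (\<theta> * y) \<le> exp (- (\<theta> * y)) * (2 * cosh (\<theta> * q N \<omega>))"
        by (intro mult_left_mono) auto
      then have "1 \<le> 2 * exp (- (\<theta> * y)) * cosh (\<theta> * q N \<omega>)"
        by (simp add: exp_minus ac_simps)
      then show "\<omega> \<in> {\<omega>\<in>space M. 1 \<le> ennreal (2 * exp (- (\<theta> * y))) * ?u \<omega>}"
        using w by (simp add: ennreal_mult[symmetric] cosh_real_nonneg)
    qed
    then have "emeasure M (A N) \<le> emeasure M ({\<omega>\<in>space M. 1 \<le> ennreal (2 * exp (- (\<theta> * y))) * ?u \<omega>})"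
      by (intro emeasure_mono) auto
    also have "\<dots> \<le> ennreal (2 * exp (- (\<theta> * y))) * (\<integral>\<^sup>+\<omega>. ?u \<omega> * indicator (space M) \<omega> \<partial>M)"
      using nn_integral_Markov_inequality[of ?u "space M" M "ennreal (2 * exp (- (\<theta> * y)))"]
      by simp
    also have "(\<integral>\<^sup>+\<omega>. ?u \<omega> * indicator (space M) \<omega> \<partial>M) = (\<integral>\<^sup>+\<omega>. ?u \<omega> \<partial>M)"
      by (intro nn_integral_cong) simp
    also have "ennreal (2 * exp (- (\<theta> * y))) * \<dots> \<le> ennreal (2 * exp (- (\<theta> * y))) * ennreal C"
      by (intro mult_left_mono mom) simp
    also have "\<dots> = ennreal (2 * C * exp (- (\<theta> * y)))"
      using C by (simp add: ennreal_mult[symmetric] ac_simps)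
    finally show ?thesis using C by (simp add: emeasure_eq_measure)
  qed
  have "(\<Union>N. A N) = {\<omega>\<in>space M. \<exists>N. q N \<omega> > y}" by (auto simp: A_def)
  then show ?thesis using LIMSEQ_le_const2[OF lim] bd by auto
qed

lemma borel_measurable_L2_set:
  assumes "\<And>i. i \<in> A \<Longrightarrow> (\<lambda>z. f z i) \<in> borel_measurable M"
  shows "(\<lambda>z. L2_set (f z) A) \<in> borel_measurable M"
  unfolding L2_set_def using assms
  by (intro measurable_compose[OF _ borel_measurable_sqrt] borel_measurable_sum borel_measurable_power)

lemma abs_le_L2_set:
  assumes "finite F" "i \<in> F"
  shows "\<bar>f i\<bar> \<le> L2_set f F"
proof -
  have "(f i)\<^sup>2 \<le> (\<Sum>i\<in>F. (f i)\<^sup>2)" using assms by (intro member_le_sum) auto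
  then show ?thesis using real_sqrt_le_mono unfolding L2_set_def by fastforce
qed

text \<open>Chernoff's method for a norm, with \<open>step\<close> as the one-summand bound at every
  scale and shift, uniform in the truncation level \<open>k\<close>. The prefactor \<open>2\<close>
  is the loss in passing from \<open>exp\<close> to \<open>cosh\<close>.\<close>

lemma measure_PiM_sum_exceeds_le:
  fixes \<xi> :: "'z \<Rightarrow> 'i \<Rightarrow> real" and F :: "nat \<Rightarrow> 'i set" and n :: nat and c y :: real
  assumes N: "prob_space N" and n: "n \<ge> 1" and c: "c > 0" and y: "y \<ge> 0"
    and F: "\<And>k. finite (F k)" "\<And>k. F k \<subseteq> F (Suc k)"
    and meas: "\<And>k i. i \<in> F k \<Longrightarrow> (\<lambda>z. \<xi> z i) \<in> borel_measurable N"
    and step: "\<And>k \<theta> s. (\<integral>\<^sup>+z. ennreal (cosh (L2_set (\<lambda>i. s i + \<theta> * \<xi> z i) (F k))) \<partial>N)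
           \<le> ennreal (exp (c * \<theta>\<^sup>2)) * ennreal (cosh (L2_set s (F k)))"
  shows "measure (PiM {..<n} (\<lambda>_. N)) {\<omega> \<in> space (PiM {..<n} (\<lambda>_. N)).
            \<exists>k. L2_set (\<lambda>i. \<Sum>j<n. \<xi> (\<omega> j) i) (F k) > y} \<le> 2 * exp (- (y\<^sup>2 / (4 * n * c)))"
    and "{\<omega> \<in> space (PiM {..<n} (\<lambda>_. N)). \<exists>k. L2_set (\<lambda>i. \<Sum>j<n. \<xi> (\<omega> j) i) (F k) > y}
            \<in> sets (PiM {..<n} (\<lambda>_. N))"
proof -
  \<comment> \<open>The minimiser of the exponent
    \<open>n * c * \<theta>\<^sup>2 - \<theta> * y\<close>.\<close>
  define \<theta> where "\<theta> = y / (2 * n * c)"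
  have \<theta>: "0 \<le> \<theta>" using n c y by (simp add: \<theta>_def)
  interpret P: prob_space "PiM {..<n} (\<lambda>_. N)" using N by (intro prob_space_PiM)
  have coord: "(\<lambda>\<omega>. \<xi> (\<omega> j) i) \<in> borel_measurable (PiM {..<m} (\<lambda>_. N))" if "i \<in> F k" "j < m" for i j k m
    using measurable_comp[OF measurable_component_singleton[of j "{..<m}" "\<lambda>_. N"] meas[OF that(1)]] that(2)
    by (simp add: comp_def)
  have qm: "(\<lambda>\<omega>. L2_set (\<lambda>i. \<Sum>j<m. \<xi> (\<omega> j) i) (F k)) \<in> borel_measurable (PiM {..<m} (\<lambda>_. N))" for k m
    using coord by (intro borel_measurable_L2_set borel_measurable_sum) auto
  have scale: "L2_set (\<lambda>i. \<theta> * g i) A = \<theta> * L2_set g A" for g :: "'i \<Rightarrow> real" and A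
    using L2_set_right_distrib[OF \<theta>] by metis
  have mom: "(\<integral>\<^sup>+\<omega>. ennreal (cosh (\<theta> * L2_set (\<lambda>i. \<Sum>j<n. \<xi> (\<omega> j) i) (F k))) \<partial>PiM {..<n} (\<lambda>_. N))
      \<le> ennreal (exp (n * (c * \<theta>\<^sup>2)))" for k
  proof -
    have "(\<integral>\<^sup>+\<omega>. ennreal (cosh (L2_set (\<lambda>i. \<Sum>j<n. \<theta> * \<xi> (\<omega> j) i) (F k))) \<partial>PiM {..<n} (\<lambda>_. N))
        \<le> ennreal (exp (c * \<theta>\<^sup>2)) ^ n * ennreal (cosh (L2_set (\<lambda>_. 0) (F k)))"
    proof (rule nn_integral_PiM_sum_le[OF N])
      show "(\<lambda>\<omega>. ennreal (cosh (L2_set (\<lambda>i. \<Sum>j<m. \<theta> * \<xi> (\<omega> j) i) (F k))))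
          \<in> borel_measurable (PiM {..<m} (\<lambda>_. N))" for m
        unfolding sum_distrib_left[symmetric] scale
        using qm[of m k] by measurable
    qed (rule step)
    then show ?thesis
      by (simp add: sum_distrib_left[symmetric] scale ennreal_power exp_of_nat_mult[symmetric] L2_set_def)
  qed
  have "measure (PiM {..<n} (\<lambda>_. N)) {\<omega> \<in> space (PiM {..<n} (\<lambda>_. N)).
            \<exists>k. L2_set (\<lambda>i. \<Sum>j<n. \<xi> (\<omega> j) i) (F k) > y} \<le> 2 * exp (n * (c * \<theta>\<^sup>2)) * exp (- (\<theta> * y))"
  proof (rule P.measure_exceeds_le_of_cosh[OF qm])
    show "L2_set (\<lambda>i. \<Sum>j<n. \<xi> (\<omega> j) i) (F k) \<le> L2_set (\<lambda>i. \<Sum>j<n. \<xi> (\<omega> j) i) (F (Suc k))" for \<omega> k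
      unfolding L2_set_def by (intro real_sqrt_le_mono sum_mono2 F) auto
  qed (use mom \<theta> in auto)
  also have "n * (c * \<theta>\<^sup>2) = \<theta> * y / 2"
    using n c by (simp add: \<theta>_def power2_eq_square field_simps)
  also have "2 * exp (\<theta> * y / 2) * exp (- (\<theta> * y)) = 2 * exp (- (\<theta> * y / 2))"
    by (simp add: mult.assoc exp_add[symmetric])
  also have "\<theta> * y / 2 = y\<^sup>2 / (4 * n * c)"
    by (simp add: \<theta>_def power2_eq_square)
  finally show "measure (PiM {..<n} (\<lambda>_. N)) {\<omega> \<in> space (PiM {..<n} (\<lambda>_. N)).
            \<exists>k. L2_set (\<lambda>i. \<Sum>j<n. \<xi> (\<omega> j) i) (F k) > y} \<le> 2 * exp (- (y\<^sup>2 / (4 * n * c)))" .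
  show "{\<omega> \<in> space (PiM {..<n} (\<lambda>_. N)). \<exists>k. L2_set (\<lambda>i. \<Sum>j<n. \<xi> (\<omega> j) i) (F k) > y}
            \<in> sets (PiM {..<n} (\<lambda>_. N))"
    using qm[of n] by measurable
qed

lemma nn_integral_cosh_scaled_centred_le:
  assumes N: "prob_space N" and F: "finite F"
    and meas: "\<And>i. i \<in> F \<Longrightarrow> (\<lambda>z. \<xi> z i) \<in> borel_measurable N"
    and zero: "\<And>i. i \<in> F \<Longrightarrow> (\<integral>z. \<xi> z i \<partial>N) = 0"
    and bd: "\<And>z. L2_set (\<xi> z) F \<le> a"
  shows "(\<integral>\<^sup>+z. ennreal (cosh (L2_set (\<lambda>i. s i + \<theta> * \<xi> z i) F)) \<partial>N)
           \<le> ennreal (exp (a\<^sup>2 * \<theta>\<^sup>2)) * ennreal (cosh (L2_set s F))"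
proof -
  interpret prob_space N by fact
  have "\<bar>\<xi> z i\<bar> \<le> a" if "i \<in> F" for z i
    using abs_le_L2_set[OF F that, of "\<xi> z"] bd[of z] by linarith
  then have int: "integrable N (\<lambda>z. \<xi> z i)" if "i \<in> F" for i
    using that by (intro integrable_const_bound[of _ a] meas) auto
  have norm: "L2_set (\<lambda>i. \<theta> * \<xi> z i) F = \<bar>\<theta>\<bar> * L2_set (\<xi> z) F" for z
    using L2_set_right_distrib[of "\<bar>\<theta>\<bar>" "\<xi> z" F] unfolding L2_set_def by (simp add: power_mult_distrib)
  have "(\<integral>\<^sup>+z. ennreal (cosh (L2_set (\<lambda>i. s i + \<theta> * \<xi> z i) F)) \<partial>N)
           \<le> ennreal (exp ((\<bar>\<theta>\<bar> * a)\<^sup>2)) * ennreal (cosh (L2_set s F))"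
    using meas int zero bd by (intro nn_integral_cosh_centred_le F) (auto simp: norm mult_left_mono)
  then show ?thesis by (simp add: power_mult_distrib mult.commute)
qed

text \<open>Given the design point, the summand is a Gaussian multiple of a fixed vector. The inner
  integral over the noise is therefore bounded uniformly in the design point, and the outer integral
  has total mass one.\<close>

lemma nn_integral_cosh_scaled_normal_le:
  fixes k :: "'x \<Rightarrow> 'i \<Rightarrow> real"
  assumes U: "prob_space U" and F: "finite F"
    and meas: "\<And>i. i \<in> F \<Longrightarrow> (\<lambda>x. k x i) \<in> borel_measurable U"
    and bd: "\<And>x. L2_set (k x) F \<le> a"
  shows "(\<integral>\<^sup>+z. ennreal (cosh (L2_set (\<lambda>i. s i + \<theta> * (snd z * k (fst z) i)) F))
             \<partial>(U \<Otimes>\<^sub>M density lborel std_normal_density))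
           \<le> ennreal (exp (a\<^sup>2 / 2 * \<theta>\<^sup>2)) * ennreal (cosh (L2_set s F))"
proof -
  let ?G = "density lborel std_normal_density"
  interpret U: prob_space U by fact
  interpret G: prob_space ?G by (rule prob_space_normal_density) simp
  have meas': "(\<lambda>z. ennreal (cosh (L2_set (\<lambda>i. s i + \<theta> * (snd z * k (fst z) i)) F)))
      \<in> borel_measurable (U \<Otimes>\<^sub>M ?G)"
  proof -
    have "(\<lambda>z. k (fst z) i) \<in> borel_measurable (U \<Otimes>\<^sub>M ?G)" if "i \<in> F" for i
      using measurable_compose[OF measurable_fst meas[OF that]] .
    moreover have "snd \<in> borel_measurable (U \<Otimes>\<^sub>M ?G)"
      using measurable_snd[of U ?G] by (simp add: measurable_def)
    ultimately have "(\<lambda>z. L2_set (\<lambda>i. s i + \<theta> * (snd z * k (fst z) i)) F) \<in> borel_measurable (U \<Otimes>\<^sub>M ?G)"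
      by (intro borel_measurable_L2_set borel_measurable_add borel_measurable_times) auto
    then show ?thesis by measurable
  qed
  have norm: "(L2_set (\<lambda>i. \<theta> * k x i) F)\<^sup>2 \<le> a\<^sup>2 * \<theta>\<^sup>2" for x
  proof -
    have "L2_set (\<lambda>i. \<theta> * k x i) F = \<bar>\<theta>\<bar> * L2_set (k x) F"
      using L2_set_right_distrib[of "\<bar>\<theta>\<bar>" "k x" F] unfolding L2_set_def by (simp add: power_mult_distrib)
    then show ?thesis
      using power_mono[OF bd[of x] L2_set_nonneg, of 2] by (simp add: power_mult_distrib mult.commute mult_left_mono)
  qed
  have inner: "(\<integral>\<^sup>+e. ennreal (cosh (L2_set (\<lambda>i. s i + \<theta> * (e * k x i)) F)) \<partial>?G)
      \<le> ennreal (exp (a\<^sup>2 / 2 * \<theta>\<^sup>2)) * ennreal (cosh (L2_set s F))" for x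
  proof -
    have "(\<integral>\<^sup>+e. ennreal (cosh (L2_set (\<lambda>i. s i + e * (\<theta> * k x i)) F)) \<partial>?G)
        \<le> ennreal (exp ((L2_set (\<lambda>i. \<theta> * k x i) F)\<^sup>2 / 2)) * ennreal (cosh (L2_set s F))"
      by (rule nn_integral_cosh_normal_multiple_le[OF F])
    also have "\<dots> \<le> ennreal (exp (a\<^sup>2 / 2 * \<theta>\<^sup>2)) * ennreal (cosh (L2_set s F))"
      using norm[of x] by (intro mult_right_mono ennreal_leI) auto
    finally show ?thesis by (simp add: ac_simps)
  qed
  have "(\<integral>\<^sup>+z. ennreal (cosh (L2_set (\<lambda>i. s i + \<theta> * (snd z * k (fst z) i)) F)) \<partial>(U \<Otimes>\<^sub>M ?G))
      = (\<integral>\<^sup>+x. (\<integral>\<^sup>+e. ennreal (cosh (L2_set (\<lambda>i. s i + \<theta> * (e * k x i)) F)) \<partial>?G) \<partial>U)"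
    by (subst G.nn_integral_fst[OF meas', symmetric]) simp
  also have "\<dots> \<le> (\<integral>\<^sup>+x. ennreal (exp (a\<^sup>2 / 2 * \<theta>\<^sup>2)) * ennreal (cosh (L2_set s F)) \<partial>U)"
    by (intro nn_integral_mono inner)
  finally show ?thesis by (simp add: U.emeasure_space_1)
qed

section \<open>The Sobolev space\<close>

lemma abs_cont_on_imp_continuous_on:
  assumes "abs_cont_on a b f"
  shows "continuous_on {a..b} f"
  unfolding continuous_on_iff
proof (intro ballI allI impI)
  fix x e :: real assume x: "x \<in> {a..b}" and "0 < e"
  obtain d where "d > 0" and d: "\<forall>(k::nat) (u::nat \<Rightarrow> real) (v::nat \<Rightarrow> real).
        (\<forall>i<k. a \<le> u i \<and> u i \<le> v i \<and> v i \<le> b) \<and>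
        (\<forall>i<k. \<forall>j<k. i \<noteq> j \<longrightarrow> v i \<le> u j \<or> v j \<le> u i) \<and>
        (\<Sum>i<k. v i - u i) < d
        \<longrightarrow> (\<Sum>i<k. \<bar>f (v i) - f (u i)\<bar>) < e"
    using assms[unfolded abs_cont_on_def, THEN spec, THEN mp, OF \<open>0 < e\<close>] by (elim exE conjE)
  show "\<exists>d>0. \<forall>x'\<in>{a..b}. dist x' x < d \<longrightarrow> dist (f x') (f x) < e"
  proof (intro exI[of _ d] conjI ballI impI)
    fix x' assume x': "x' \<in> {a..b}" "dist x' x < d"
    show "dist (f x') (f x) < e"
      using d[THEN spec, of 1, THEN spec, of "\<lambda>_. min x x'", THEN spec, of "\<lambda>_. max x x'"] x x'
      by (auto simp: dist_real_def min_def max_def abs_if split: if_splits)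
  qed fact
qed

lemma abs_cont_on_lincomb:
  assumes f: "abs_cont_on a b f" and g: "abs_cont_on a b g"
  shows "abs_cont_on a b (\<lambda>x. \<alpha> * f x + \<beta> * g x)"
  unfolding abs_cont_on_def
proof (intro allI impI)
  fix e :: real assume "e > 0"
  \<comment> \<open>The extra \<open>1\<close> keeps \<open>C\<close> positive when both
    coefficients vanish and makes the last estimate strict.\<close>
  define C where "C = \<bar>\<alpha>\<bar> + \<bar>\<beta>\<bar> + 1"
  have "C > 0" unfolding C_def by linarith
  then have e': "e / C > 0" using \<open>e > 0\<close> by simp
  obtain d1 where "d1 > 0" and d1: "\<forall>(k::nat) (u::nat \<Rightarrow> real) (v::nat \<Rightarrow> real).
        (\<forall>i<k. a \<le> u i \<and> u i \<le> v i \<and> v i \<le> b) \<and>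
        (\<forall>i<k. \<forall>j<k. i \<noteq> j \<longrightarrow> v i \<le> u j \<or> v j \<le> u i) \<and>
        (\<Sum>i<k. v i - u i) < d1
        \<longrightarrow> (\<Sum>i<k. \<bar>f (v i) - f (u i)\<bar>) < e / C"
    using f[unfolded abs_cont_on_def, THEN spec, THEN mp, OF e'] by (elim exE conjE)
  obtain d2 where "d2 > 0" and d2: "\<forall>(k::nat) (u::nat \<Rightarrow> real) (v::nat \<Rightarrow> real).
        (\<forall>i<k. a \<le> u i \<and> u i \<le> v i \<and> v i \<le> b) \<and>
        (\<forall>i<k. \<forall>j<k. i \<noteq> j \<longrightarrow> v i \<le> u j \<or> v j \<le> u i) \<and>
        (\<Sum>i<k. v i - u i) < d2
        \<longrightarrow> (\<Sum>i<k. \<bar>g (v i) - g (u i)\<bar>) < e / C"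
    using g[unfolded abs_cont_on_def, THEN spec, THEN mp, OF e'] by (elim exE conjE)
  show "\<exists>d>0. \<forall>(k::nat) (u::nat \<Rightarrow> real) (v::nat \<Rightarrow> real).
        (\<forall>i<k. a \<le> u i \<and> u i \<le> v i \<and> v i \<le> b) \<and>
        (\<forall>i<k. \<forall>j<k. i \<noteq> j \<longrightarrow> v i \<le> u j \<or> v j \<le> u i) \<and>
        (\<Sum>i<k. v i - u i) < d
        \<longrightarrow> (\<Sum>i<k. \<bar>(\<alpha> * f (v i) + \<beta> * g (v i)) - (\<alpha> * f (u i) + \<beta> * g (u i))\<bar>) < e"
  proof (intro exI[of _ "min d1 d2"] conjI allI impI; (elim conjE)?)
    show "min d1 d2 > 0" using \<open>d1 > 0\<close> \<open>d2 > 0\<close> by simp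
    fix k :: nat and u v :: "nat \<Rightarrow> real"
    assume uv: "\<forall>i<k. a \<le> u i \<and> u i \<le> v i \<and> v i \<le> b"
      "\<forall>i<k. \<forall>j<k. i \<noteq> j \<longrightarrow> v i \<le> u j \<or> v j \<le> u i" "(\<Sum>i<k. v i - u i) < min d1 d2"
    have F: "(\<Sum>i<k. \<bar>f (v i) - f (u i)\<bar>) < e / C" by (rule d1[THEN spec, THEN spec, THEN spec, THEN mp]) (use uv in auto)
    have G: "(\<Sum>i<k. \<bar>g (v i) - g (u i)\<bar>) < e / C" by (rule d2[THEN spec, THEN spec, THEN spec, THEN mp]) (use uv in auto)
    have "(\<Sum>i<k. \<bar>(\<alpha> * f (v i) + \<beta> * g (v i)) - (\<alpha> * f (u i) + \<beta> * g (u i))\<bar>)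
        \<le> (\<Sum>i<k. \<bar>\<alpha>\<bar> * \<bar>f (v i) - f (u i)\<bar> + \<bar>\<beta>\<bar> * \<bar>g (v i) - g (u i)\<bar>)"
    proof (intro sum_mono)
      fix i
      have "(\<alpha> * f (v i) + \<beta> * g (v i)) - (\<alpha> * f (u i) + \<beta> * g (u i))
          = \<alpha> * (f (v i) - f (u i)) + \<beta> * (g (v i) - g (u i))" by (simp add: algebra_simps)
      then show "\<bar>(\<alpha> * f (v i) + \<beta> * g (v i)) - (\<alpha> * f (u i) + \<beta> * g (u i))\<bar>
          \<le> \<bar>\<alpha>\<bar> * \<bar>f (v i) - f (u i)\<bar> + \<bar>\<beta>\<bar> * \<bar>g (v i) - g (u i)\<bar>"
        using abs_triangle_ineq by (simp add: abs_mult[symmetric])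
    qed
    also have "\<dots> = \<bar>\<alpha>\<bar> * (\<Sum>i<k. \<bar>f (v i) - f (u i)\<bar>) + \<bar>\<beta>\<bar> * (\<Sum>i<k. \<bar>g (v i) - g (u i)\<bar>)"
      by (simp add: sum.distrib sum_distrib_left)
    also have "\<dots> \<le> \<bar>\<alpha>\<bar> * (e / C) + \<bar>\<beta>\<bar> * (e / C)"
      using F G by (intro add_mono mult_left_mono) auto
    also have "\<dots> < C * (e / C)"
    proof -
      have "C * q = \<bar>\<alpha>\<bar> * q + \<bar>\<beta>\<bar> * q + q" for q by (simp add: C_def algebra_simps)
      from this[of "e / C"] show ?thesis using e' by linarith
    qed
    finally show "(\<Sum>i<k. \<bar>(\<alpha> * f (v i) + \<beta> * g (v i)) - (\<alpha> * f (u i) + \<beta> * g (u i))\<bar>) < e"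
      using \<open>C > 0\<close> by simp
  qed
qed

lemma square_integrable_mult:
  fixes d e :: "real \<Rightarrow> real"
  assumes [measurable]: "d \<in> borel_measurable lborel" "e \<in> borel_measurable lborel"
    and "integrable lborel (\<lambda>x. (d x)\<^sup>2)" "integrable lborel (\<lambda>x. (e x)\<^sup>2)"
  shows "integrable lborel (\<lambda>x. d x * e x)"
proof (rule Bochner_Integration.integrable_bound)
  show "integrable lborel (\<lambda>x. (d x)\<^sup>2 + (e x)\<^sup>2)" using assms by simp
  have "\<bar>p * q\<bar> \<le> p\<^sup>2 + q\<^sup>2" for p q :: real
  proof -
    have "2 * (\<bar>p\<bar> * \<bar>q\<bar>) \<le> p\<^sup>2 + q\<^sup>2" using sum_squares_bound[of "\<bar>p\<bar>" "\<bar>q\<bar>"] by (simp add: mult.assoc)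
    then show ?thesis unfolding abs_mult using mult_nonneg_nonneg[of "\<bar>p\<bar>" "\<bar>q\<bar>"] by linarith
  qed
  then show "AE x in lborel. norm (d x * e x) \<le> norm ((d x)\<^sup>2 + (e x)\<^sup>2)" by simp
qed measurable

lemma square_integrable_lincomb:
  fixes d e :: "real \<Rightarrow> real"
  assumes [measurable]: "d \<in> borel_measurable lborel" "e \<in> borel_measurable lborel"
    and "integrable lborel (\<lambda>x. (d x)\<^sup>2)" "integrable lborel (\<lambda>x. (e x)\<^sup>2)"
  shows "integrable lborel (\<lambda>x. (\<alpha> * d x + \<beta> * e x)\<^sup>2)"
proof -
  have "(\<lambda>x. (\<alpha> * d x + \<beta> * e x)\<^sup>2) = (\<lambda>x. \<alpha>\<^sup>2 * (d x)\<^sup>2 + 2 * \<alpha> * \<beta> * (d x * e x) + \<beta>\<^sup>2 * (e x)\<^sup>2)"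
    by (auto simp: fun_eq_iff power2_eq_square algebra_simps)
  then show ?thesis using square_integrable_mult[OF assms] assms(3,4) by simp
qed

lemma indicator_scaleR_power2: "indicator A x *\<^sub>R (f x :: real)\<^sup>2 = (indicator A x * f x)\<^sup>2"
  by (simp add: indicator_def)

lemma sob_chain_top:
  assumes "sob_chain m f D"
  shows "(\<lambda>x. indicator {0..1} x * D m x) \<in> borel_measurable lborel"
    and "integrable lborel (\<lambda>x. (indicator {0..1} x * D m x)\<^sup>2)"
  using assms unfolding sob_chain_def set_borel_measurable_def set_integrable_def indicator_scaleR_power2
  by simp_all

lemma sob_chain_lincomb:
  assumes f: "sob_chain m f D" and g: "sob_chain m g E"
  shows "sob_chain m (\<lambda>x. a * f x + b * g x) (\<lambda>j x. a * D j x + b * E j x)"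
  unfolding sob_chain_def
proof (intro conjI ballI allI impI)
  fix x :: real assume "x \<in> {0..1}"
  then show "a * D 0 x + b * E 0 x = a * f x + b * g x"
    using f g by (simp add: sob_chain_def)
next
  fix j assume j: "j < m"
  then show "abs_cont_on 0 1 (\<lambda>x. a * D j x + b * E j x)"
    using f g by (intro abs_cont_on_lincomb) (auto simp: sob_chain_def)
  have "AE x in lborel. x \<in> {0<..<1} \<longrightarrow> (D j has_real_derivative D (Suc j) x) (at x)"
    "AE x in lborel. x \<in> {0<..<1} \<longrightarrow> (E j has_real_derivative E (Suc j) x) (at x)"
    using f g j unfolding sob_chain_def by blast+
  then show "AE x in lborel. x \<in> {0<..<1} \<longrightarrow>
      ((\<lambda>x. a * D j x + b * E j x) has_real_derivative a * D (Suc j) x + b * E (Suc j) x) (at x)"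
  proof eventually_elim
    case (elim x)
    then show ?case by (auto intro!: DERIV_add DERIV_cmult)
  qed
next
  have eq: "indicator {0..1} x *\<^sub>R (a * D m x + b * E m x)
      = a * (indicator {0..1} x * D m x) + b * (indicator {0..1} x * E m x)" for x :: real
    by (simp add: indicator_def)
  show "set_borel_measurable lborel {0..1} (\<lambda>x. a * D m x + b * E m x)"
    unfolding set_borel_measurable_def eq
    using sob_chain_top(1)[OF f] sob_chain_top(1)[OF g] by measurable
  have "set_integrable lborel {0..1} (\<lambda>x. (a * D m x + b * E m x)\<^sup>2)
     \<longleftrightarrow> integrable lborel (\<lambda>x. (a * (indicator {0..1} x * D m x) + b * (indicator {0..1} x * E m x))\<^sup>2)"
    unfolding set_integrable_def
    by (intro arg_cong[where f = "integrable lborel"]) (auto simp: fun_eq_iff indicator_def)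
  then show "set_integrable lborel {0..1} (\<lambda>x. (a * D m x + b * E m x)\<^sup>2)"
    using square_integrable_lincomb[OF sob_chain_top(1)[OF f] sob_chain_top(1)[OF g]
        sob_chain_top(2)[OF f] sob_chain_top(2)[OF g]] by simp
qed

text \<open>The set where the two functions differ is open, and a nonempty open set is not a null
  set.\<close>

lemma continuous_AE_eq_imp_eq:
  fixes f g :: "real \<Rightarrow> real"
  assumes S: "open S" and f: "continuous_on S f" and g: "continuous_on S g"
    and ae: "AE x in lborel. x \<in> S \<longrightarrow> f x = g x" and x: "x \<in> S"
  shows "f x = g x"
proof (rule ccontr)
  define U where "U = {x \<in> S. f x - g x \<in> - {0}}"
  assume "f x \<noteq> g x"
  then have "U \<noteq> {}" using x by (auto simp: U_def)
  have op: "open U"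
    using continuous_open_preimage[of S "\<lambda>x. f x - g x" "- {0}"] S f g
    unfolding U_def by (auto intro!: continuous_intros simp: vimage_def Int_def)
  have "AE x in lborel. x \<notin> U" using ae by eventually_elim (auto simp: U_def)
  then have "U \<in> null_sets lborel" using op
    by (subst (asm) AE_iff_null_sets[symmetric]) auto
  then have "U \<in> null_sets lebesgue" using op by (subst null_sets_completion_iff) auto
  then show False using open_not_negligible[OF op \<open>U \<noteq> {}\<close>] by (simp add: negligible_iff_null_sets)
qed

text \<open>Makes the choice in \<open>sob_deriv\<close> immaterial up to null sets, hence
  \<open>Jm\<close> well defined. By induction on the order: continuity upgrades almost everywhere
  equality of \<open>D j\<close> and \<open>E j\<close> to equality on the open interval, and only
  then do their derivatives agree wherever both exist.\<close>

lemma sob_chain_unique: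
  assumes D: "sob_chain m f D" and E: "sob_chain m f E"
  shows "AE x in lborel. x \<in> {0..1} \<longrightarrow> D m x = E m x"
proof -
  have "j \<le> m \<Longrightarrow> AE x in lborel. x \<in> {0<..<1} \<longrightarrow> D j x = E j x" for j
  proof (induction j)
    case 0
    then show ?case using D E by (simp add: sob_chain_def)
  next
    case (Suc j)
    then have j: "j < m" by simp
    have "continuous_on {0..1} (D j)" "continuous_on {0..1} (E j)"
      using D E j by (auto simp: sob_chain_def intro: abs_cont_on_imp_continuous_on)
    then have c: "continuous_on {0<..<1} (D j)" "continuous_on {0<..<1} (E j)"
      by (auto elim: continuous_on_subset)
    have ae: "AE x in lborel. x \<in> {0<..<1} \<longrightarrow> D j x = E j x" using Suc by simp
    have eq: "D j x = E j x" if "x \<in> {0<..<1}" for x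
      by (rule continuous_AE_eq_imp_eq[OF _ c ae that]) simp
    have "AE x in lborel. x \<in> {0<..<1} \<longrightarrow> (D j has_real_derivative D (Suc j) x) (at x)"
      "AE x in lborel. x \<in> {0<..<1} \<longrightarrow> (E j has_real_derivative E (Suc j) x) (at x)"
      using D E j unfolding sob_chain_def by blast+
    then show ?case
    proof eventually_elim
      case (elim x)
      show ?case
      proof
        assume x: "x \<in> {0<..<1}"
        then have "(D j has_real_derivative D (Suc j) x) (at x)" using elim by simp
        then have "(E j has_real_derivative D (Suc j) x) (at x)"
          by (rule has_field_derivative_transform_within_open[OF _ open_greaterThanLessThan x eq])
        then show "D (Suc j) x = E (Suc j) x" using elim x by (auto dest: DERIV_unique)
      qed
    qed
  qed
  from this[OF order_refl] AE_lborel_singleton[of 0] AE_lborel_singleton[of 1]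
  show ?thesis by eventually_elim auto
qed

lemma sob_chain_cong:
  assumes "\<And>x. x \<in> {0..1} \<Longrightarrow> f x = g x"
  shows "sob_chain m f = sob_chain m g"
  using assms by (auto simp: fun_eq_iff sob_chain_def)

lemma sobolev_cong:
  assumes "\<And>x. x \<in> {0..1} \<Longrightarrow> f x = g x"
  shows "f \<in> sobolev m \<longleftrightarrow> g \<in> sobolev m" "sob_deriv m f = sob_deriv m g"
  using sob_chain_cong[OF assms] by (simp_all add: sobolev_def sob_deriv_def)

lemma sobolev_lincomb:
  assumes "f \<in> sobolev m" "g \<in> sobolev m"
  shows "(\<lambda>x. a * f x + b * g x) \<in> sobolev m"
  using assms sob_chain_lincomb unfolding sobolev_def by fast

lemma sob_deriv_AE:
  assumes "sob_chain m f D"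
  shows "AE x in lborel. x \<in> {0..1} \<longrightarrow> sob_deriv m f x = D m x"
  unfolding sob_deriv_def by (rule sob_chain_unique[OF someI[of "sob_chain m f", OF assms] assms])

lemma sob_deriv_top:
  assumes "f \<in> sobolev m"
  shows "(\<lambda>x. indicator {0..1} x * sob_deriv m f x) \<in> borel_measurable lborel"
    and "integrable lborel (\<lambda>x. (indicator {0..1} x * sob_deriv m f x)\<^sup>2)"
  using assms sob_chain_top[OF someI_ex[of "sob_chain m f"]] unfolding sob_deriv_def sobolev_def by auto

text \<open>The choice operator selects the chains of \<open>f\<close>, \<open>g\<close> and the
  combination independently, so linearity of the derivative survives only almost everywhere.\<close>

lemma sob_deriv_lincomb:
  assumes f: "f \<in> sobolev m" and g: "g \<in> sobolev m"
  shows "AE x in lborel. x \<in> {0..1} \<longrightarrow>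
    sob_deriv m (\<lambda>x. a * f x + b * g x) x = a * sob_deriv m f x + b * sob_deriv m g x"
proof -
  have "sob_chain m f (SOME D. sob_chain m f D)" "sob_chain m g (SOME D. sob_chain m g D)"
    using f g by (simp_all add: sobolev_def some_eq_ex)
  then show ?thesis unfolding sob_deriv_def[of m f] sob_deriv_def[of m g]
    by (intro sob_deriv_AE sob_chain_lincomb)
qed

lemma Jm_eq: "Jm m f g = (LINT x|lborel. (indicator {0..1} x * sob_deriv m f x) * (indicator {0..1} x * sob_deriv m g x))"
  unfolding Jm_def set_lebesgue_integral_def
  by (intro Bochner_Integration.integral_cong) (auto simp: indicator_def)

lemma Jm_commute: "Jm m f g = Jm m g f"
  unfolding Jm_def by (simp add: mult.commute)

lemma Jm_nonneg: "0 \<le> Jm m f f"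
  unfolding Jm_eq by (intro integral_nonneg_AE) simp

lemma Jm_lincomb_left:
  assumes f: "f \<in> sobolev m" and g: "g \<in> sobolev m" and u: "u \<in> sobolev m"
  shows "Jm m (\<lambda>x. a * f x + b * g x) u = a * Jm m f u + b * Jm m g u"
proof -
  let ?w = "\<lambda>f x. indicator {0..1} x * sob_deriv m f x"
  have [measurable]: "?w f \<in> borel_measurable lborel" "?w g \<in> borel_measurable lborel"
      "?w u \<in> borel_measurable lborel" "?w (\<lambda>x. a * f x + b * g x) \<in> borel_measurable lborel"
    using sob_deriv_top(1) f g u sobolev_lincomb by blast+
  have "Jm m (\<lambda>x. a * f x + b * g x) u = (LINT x|lborel. a * (?w f x * ?w u x) + b * (?w g x * ?w u x))"
    unfolding Jm_eq
  proof (rule integral_cong_AE)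
    show "AE x in lborel. ?w (\<lambda>x. a * f x + b * g x) x * ?w u x = a * (?w f x * ?w u x) + b * (?w g x * ?w u x)"
      using sob_deriv_lincomb[OF f g, of a b]
      by eventually_elim (auto simp: indicator_def algebra_simps)
  qed measurable
  also have "\<dots> = a * Jm m f u + b * Jm m g u" unfolding Jm_eq
    using square_integrable_mult[OF sob_deriv_top(1)[OF f] sob_deriv_top(1)[OF u] sob_deriv_top(2)[OF f] sob_deriv_top(2)[OF u]]
      square_integrable_mult[OF sob_deriv_top(1)[OF g] sob_deriv_top(1)[OF u] sob_deriv_top(2)[OF g] sob_deriv_top(2)[OF u]]
    by simp
  finally show ?thesis .
qed

lemma sobolev_continuous_on:
  assumes "f \<in> sobolev m" "m \<ge> 1"
  shows "continuous_on {0..1} f"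
proof -
  obtain D where D: "sob_chain m f D" using assms by (auto simp: sobolev_def)
  then have "continuous_on {0..1} (D 0)"
    using assms by (auto simp: sob_chain_def intro: abs_cont_on_imp_continuous_on)
  moreover have "continuous_on {0..1} (D 0) = continuous_on {0..1} f"
    using D by (intro continuous_on_cong) (auto simp: sob_chain_def)
  ultimately show ?thesis by simp
qed

section \<open>The square-integral form on the unit interval\<close>

definition clip :: "(real \<Rightarrow> real) \<Rightarrow> real \<Rightarrow> real" where
  "clip f x = indicator {0..1} x * f x"

text \<open>Functions in \<^const>\<open>sobolev\<close> are arbitrary outside the unit interval, where they may even fail
  to be measurable; \<^const>\<open>Vf\<close> then takes the junk value \<open>0\<close>.  The form below ignores those values.\<close>
definition V01 :: "(real \<Rightarrow> real) \<Rightarrow> (real \<Rightarrow> real) \<Rightarrow> real" where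
  "V01 f g = (LINT x|lborel. clip f x * clip g x)"

lemma clip_eq [simp]: "x \<in> {0..1} \<Longrightarrow> clip f x = f x" "0 \<le> x \<Longrightarrow> x \<le> 1 \<Longrightarrow> clip f x = f x"
  by (simp_all add: clip_def)

lemma clip_lincomb: "clip (\<lambda>x. a * f x + b * g x) x = a * clip f x + b * clip g x"
  by (simp add: clip_def algebra_simps)

lemma clip_measurable:
  assumes "f \<in> sobolev m" "m \<ge> 1"
  shows "clip f \<in> borel_measurable borel"
  using borel_measurable_continuous_on_indicator[of "{0..1}" f] sobolev_continuous_on[OF assms]
  by (simp add: clip_def[abs_def] real_scaleR_def)

lemma clip_bounded:
  assumes "f \<in> sobolev m" "m \<ge> 1"
  obtains B where "\<And>x. \<bar>clip f x\<bar> \<le> B"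
proof -
  have "bounded (f ` {0..1})"
    using compact_continuous_image[OF sobolev_continuous_on[OF assms]] compact_imp_bounded by blast
  then obtain B where "\<And>x. x \<in> {0..1} \<Longrightarrow> \<bar>f x\<bar> \<le> B" unfolding bounded_iff by force
  then have "\<bar>clip f x\<bar> \<le> \<bar>B\<bar>" for x by (cases "x \<in> {0..1}") (force simp: clip_def)+
  then show ?thesis by (rule that)
qed

lemma clip_square_integrable:
  assumes "f \<in> sobolev m" "m \<ge> 1"
  shows "integrable lborel (\<lambda>x. (clip f x)\<^sup>2)"
proof -
  obtain B where B: "\<And>x. \<bar>clip f x\<bar> \<le> B" using clip_bounded[OF assms] by blast
  have [measurable]: "clip f \<in> borel_measurable borel" by (rule clip_measurable[OF assms])
  have "integrable lborel (\<lambda>x. B\<^sup>2 * indicator {0..1::real} x)"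
    by (intro integrable_mult_right integrable_real_indicator) auto
  then show ?thesis
  proof (rule Bochner_Integration.integrable_bound)
    have sq: "(clip f x)\<^sup>2 \<le> B\<^sup>2" for x using B[of x] by (metis abs_ge_zero power2_abs power_mono)
    have "norm ((clip f x)\<^sup>2) \<le> norm (B\<^sup>2 * indicator {0..1} x)" for x
      using sq[of x] by (cases "x \<in> {0..1}") (auto simp: clip_def)
    then show "AE x in lborel. norm ((clip f x)\<^sup>2) \<le> norm (B\<^sup>2 * indicator {0..1} x)" by simp
  qed measurable
qed

lemma V01_integrable:
  assumes "f \<in> sobolev m" "g \<in> sobolev m" "m \<ge> 1"
  shows "integrable lborel (\<lambda>x. clip f x * clip g x)"
  using assms clip_measurable clip_square_integrable by (intro square_integrable_mult) auto

lemma V01_commute: "V01 f g = V01 g f"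
  unfolding V01_def by (simp add: mult.commute)

lemma V01_nonneg: "0 \<le> V01 f f"
  unfolding V01_def by (intro integral_nonneg_AE) simp

lemma V01_lincomb_left:
  assumes "f \<in> sobolev m" "g \<in> sobolev m" "u \<in> sobolev m" "m \<ge> 1"
  shows "V01 (\<lambda>x. a * f x + b * g x) u = a * V01 f u + b * V01 g u"
  using V01_integrable[OF assms(1,3,4)] V01_integrable[OF assms(2,3,4)]
  unfolding V01_def clip_lincomb by (simp add: algebra_simps)

lemma V01_cong:
  assumes "\<And>x. x \<in> {0..1} \<Longrightarrow> f x = f' x" "\<And>x. x \<in> {0..1} \<Longrightarrow> g x = g' x"
  shows "V01 f g = V01 f' g'"
proof -
  have "clip f = clip f'" "clip g = clip g'" using assms by (auto simp: clip_def indicator_def)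
  then show ?thesis by (simp add: V01_def)
qed

lemma uniform_measure_unit_interval:
  "uniform_measure lborel {0..1::real} = density lborel (\<lambda>x. ennreal (indicator {0..1} x))"
  unfolding uniform_measure_def by (intro arg_cong[where f = "density lborel"]) (auto simp: indicator_def)

lemma integral_uniform_unit_interval:
  fixes f :: "real \<Rightarrow> real"
  assumes "f \<in> borel_measurable borel"
  shows "integral\<^sup>L (uniform_measure lborel {0..1}) f = (LINT x|lborel. indicator {0..1} x * f x)"
  unfolding uniform_measure_unit_interval using assms by (subst integral_density) auto

lemma Vf_eq_V01:
  assumes "(\<lambda>x. f x * g x) \<in> borel_measurable borel"
  shows "Vf f g = V01 f g"
  unfolding Vf_def V01_def integral_uniform_unit_interval[OF assms]
  by (intro Bochner_Integration.integral_cong) (auto simp: clip_def indicator_def)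

text \<open>The uniform measure carries the Borel sets of the whole line, so bad behaviour outside
  the unit interval destroys integrability and the integral takes its default value.\<close>

lemma Vf_eq_0:
  assumes "(\<lambda>x. f x * g x) \<notin> borel_measurable borel"
  shows "Vf f g = 0"
proof -
  have "\<not> integrable (uniform_measure lborel {0..1}) (\<lambda>x. f x * g x)"
    using assms by (auto dest: borel_measurable_integrable simp: measurable_def)
  then show ?thesis by (simp add: Vf_def not_integrable_integral_eq)
qed

section \<open>Semi-inner products and orthonormal expansions\<close>

locale fun_space =
  fixes S :: "('a \<Rightarrow> real) set"
  assumes lincomb_mem: "f \<in> S \<Longrightarrow> g \<in> S \<Longrightarrow> (\<lambda>x. a * f x + b * g x) \<in> S"
    and nonempty: "S \<noteq> {}"
begin

lemma zero_mem: "(\<lambda>_. 0) \<in> S"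
proof -
  obtain f where "f \<in> S" using nonempty by blast
  then show ?thesis using lincomb_mem[of f f 0 0] by simp
qed

lemma add_mem: "f \<in> S \<Longrightarrow> g \<in> S \<Longrightarrow> (\<lambda>x. f x + g x) \<in> S"
  using lincomb_mem[of f g 1 1] by simp

lemma diff_mem: "f \<in> S \<Longrightarrow> g \<in> S \<Longrightarrow> (\<lambda>x. f x - g x) \<in> S"
  using lincomb_mem[of f g 1 "-1"] by simp

lemma scale_mem: "f \<in> S \<Longrightarrow> (\<lambda>x. a * f x) \<in> S"
  using lincomb_mem[of f f a 0] by simp

lemma sum_mem:
  assumes "finite F" "\<And>i. i \<in> F \<Longrightarrow> e i \<in> S"
  shows "(\<lambda>x. \<Sum>i\<in>F. c i * e i x) \<in> S"
  using assms
proof (induction F rule: finite_induct)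
  case (insert i F)
  then show ?case using add_mem[OF scale_mem[of "e i" "c i"], of "\<lambda>x. \<Sum>i\<in>F. c i * e i x"] by simp
qed (simp add: zero_mem)

definition linear_on :: "(('a \<Rightarrow> real) \<Rightarrow> real) \<Rightarrow> bool" where
  "linear_on L \<longleftrightarrow> (\<forall>f\<in>S. \<forall>g\<in>S. \<forall>a b. L (\<lambda>x. a * f x + b * g x) = a * L f + b * L g)"

lemma linear_on_add: "linear_on L \<Longrightarrow> f \<in> S \<Longrightarrow> g \<in> S \<Longrightarrow> L (\<lambda>x. f x + g x) = L f + L g"
  unfolding linear_on_def by (elim ballE[of _ _ f] ballE[of _ _ g] allE[of _ 1]) auto

lemma linear_on_diff: "linear_on L \<Longrightarrow> f \<in> S \<Longrightarrow> g \<in> S \<Longrightarrow> L (\<lambda>x. f x - g x) = L f - L g"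
  unfolding linear_on_def by (elim ballE[of _ _ f] ballE[of _ _ g] allE[of _ 1] allE[of _ "-1"]) auto

lemma linear_on_scale: "linear_on L \<Longrightarrow> f \<in> S \<Longrightarrow> L (\<lambda>x. a * f x) = a * L f"
  unfolding linear_on_def by (elim ballE[of _ _ f] allE[of _ a] allE[of _ 0]) auto

lemma linear_on_sum:
  assumes L: "linear_on L" and "finite F" "\<And>i. i \<in> F \<Longrightarrow> e i \<in> S"
  shows "L (\<lambda>x. \<Sum>i\<in>F. c i * e i x) = (\<Sum>i\<in>F. c i * L (e i))"
  using assms(2,3)
proof (induction F rule: finite_induct)
  case empty
  then show ?case using linear_on_scale[OF L zero_mem, of 0] by simp
next
  case (insert i F)
  then have "L (\<lambda>x. c i * e i x + (\<Sum>i\<in>F. c i * e i x)) = c i * L (e i) + L (\<lambda>x. \<Sum>i\<in>F. c i * e i x)"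
    using linear_on_add[OF L scale_mem sum_mem, of "e i" F e "c i" c] linear_on_scale[OF L, of "e i" "c i"]
    by auto
  then show ?case using insert by simp
qed

end

locale psd_form = fun_space S for S :: "('a \<Rightarrow> real) set" +
  fixes T :: "('a \<Rightarrow> real) \<Rightarrow> ('a \<Rightarrow> real) \<Rightarrow> real"
  assumes lincomb_left: "f \<in> S \<Longrightarrow> g \<in> S \<Longrightarrow> u \<in> S \<Longrightarrow> T (\<lambda>x. a * f x + b * g x) u = a * T f u + b * T g u"
    and commute: "T f g = T g f"
    and nonneg: "0 \<le> T f f"
begin

lemma linear_left: "u \<in> S \<Longrightarrow> linear_on (\<lambda>f. T f u)"
  unfolding linear_on_def using lincomb_left by blast

lemma linear_right: "u \<in> S \<Longrightarrow> linear_on (T u)"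
  unfolding linear_on_def commute[of u] using lincomb_left by blast

lemma quadratic:
  assumes "f \<in> S" "g \<in> S"
  shows "T (\<lambda>x. a * f x + b * g x) (\<lambda>x. a * f x + b * g x) = a\<^sup>2 * T f f + 2 * a * b * T f g + b\<^sup>2 * T g g"
proof -
  have h: "(\<lambda>x. a * f x + b * g x) \<in> S" using assms by (rule lincomb_mem)
  show ?thesis
    unfolding lincomb_left[OF assms h] commute[of _ "\<lambda>x. a * f x + b * g x"]
    unfolding lincomb_left[OF assms assms(1)] lincomb_left[OF assms assms(2)] commute[of g f]
    by (simp add: power2_eq_square algebra_simps)
qed

definition nrm :: "('a \<Rightarrow> real) \<Rightarrow> real" where
  "nrm f = sqrt (T f f)"

lemma nrm_nonneg: "0 \<le> nrm f"
  by (simp add: nrm_def nonneg)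

lemma nrm_power2: "(nrm f)\<^sup>2 = T f f"
  by (simp add: nrm_def nonneg)

text \<open>The usual argument divides by \<open>T g g\<close>, so in the semidefinite setting the
  case where both seminorms vanish is treated apart.\<close>

lemma cauchy_schwarz:
  assumes f: "f \<in> S" and g: "g \<in> S"
  shows "(T f g)\<^sup>2 \<le> T f f * T g g"
proof -
  have pos: "(T f g)\<^sup>2 \<le> T f f * T g g" if f: "f \<in> S" and g: "g \<in> S" and p: "T g g > 0" for f g
  proof -
    \<comment> \<open>Nonnegativity at the residual of \<open>f\<close> after projection onto
      \<open>g\<close>, with denominators cleared.\<close>
    have "0 \<le> T g g * (T f f * T g g - (T f g)\<^sup>2)"
      using nonneg[of "\<lambda>x. T g g * f x + (- T f g) * g x"] unfolding quadratic[OF f g]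
      by (simp add: power2_eq_square algebra_simps)
    then show ?thesis using p by (simp add: zero_le_mult_iff)
  qed
  consider "T g g > 0" | "T f f > 0" | "T f f = 0" "T g g = 0"
    using nonneg[of f] nonneg[of g] by linarith
  then show ?thesis
  proof cases
    case 1
    then show ?thesis using pos f g by blast
  next
    case 2
    then show ?thesis using pos[OF g f] by (simp add: commute mult.commute)
  next
    case 3
    then have "0 \<le> - (2 * (T f g)\<^sup>2)"
      using nonneg[of "\<lambda>x. 1 * f x + (- T f g) * g x"] unfolding quadratic[OF f g]
      by (simp add: power2_eq_square)
    then show ?thesis using 3 by simp
  qed
qed

lemma abs_le_nrm:
  assumes "f \<in> S" "g \<in> S"
  shows "\<bar>T f g\<bar> \<le> nrm f * nrm g"
  using real_sqrt_le_mono[OF cauchy_schwarz[OF assms]] by (simp add: nrm_def real_sqrt_mult)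

lemma nrm_triangle:
  assumes f: "f \<in> S" and g: "g \<in> S"
  shows "nrm (\<lambda>x. f x + g x) \<le> nrm f + nrm g"
proof -
  have "T (\<lambda>x. f x + g x) (\<lambda>x. f x + g x) = T f f + 2 * T f g + T g g"
    using quadratic[OF f g, of 1 1] by simp
  also have "\<dots> \<le> (nrm f + nrm g)\<^sup>2"
    using abs_le_nrm[OF f g] by (simp add: power2_sum nrm_power2)
  finally show ?thesis unfolding nrm_def[of "\<lambda>x. f x + g x"]
    by (intro real_le_lsqrt) (auto simp: nrm_nonneg nonneg)
qed

end

text \<open>The index set \<open>I\<close> is a parameter because only some of the given
  eigenfunctions will enter the basis.\<close>

locale orthonormal_expansion = psd_form S T for S :: "('a \<Rightarrow> real) set" and T +
  fixes I :: "nat set" and e :: "nat \<Rightarrow> 'a \<Rightarrow> real"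
  assumes e_mem: "\<nu> \<in> I \<Longrightarrow> e \<nu> \<in> S"
    and orthonormal: "\<mu> \<in> I \<Longrightarrow> \<nu> \<in> I \<Longrightarrow> T (e \<mu>) (e \<nu>) = (if \<mu> = \<nu> then 1 else 0)"
    and complete: "g \<in> S \<Longrightarrow>
      (\<lambda>N. nrm (\<lambda>x. g x - (\<Sum>\<nu>\<in>I \<inter> {..N}. T g (e \<nu>) * e \<nu> x))) \<longlonglongrightarrow> 0"
begin

definition proj :: "nat \<Rightarrow> ('a \<Rightarrow> real) \<Rightarrow> 'a \<Rightarrow> real" where
  "proj N g = (\<lambda>x. \<Sum>\<nu>\<in>I \<inter> {..N}. T g (e \<nu>) * e \<nu> x)"

lemma proj_mem: "proj N g \<in> S"
  unfolding proj_def by (rule sum_mem) (auto intro: e_mem)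

lemma linear_on_proj: "linear_on L \<Longrightarrow> L (proj N g) = (\<Sum>\<nu>\<in>I \<inter> {..N}. T g (e \<nu>) * L (e \<nu>))"
  unfolding proj_def by (rule linear_on_sum) (auto intro: e_mem)

lemma proj_inner: "g \<in> S \<Longrightarrow> T g (proj N g) = (\<Sum>\<nu>\<in>I \<inter> {..N}. (T g (e \<nu>))\<^sup>2)"
  by (simp add: linear_on_proj linear_right power2_eq_square)

lemma proj_coeff: "\<nu> \<in> I \<Longrightarrow> \<nu> \<le> N \<Longrightarrow> T (proj N g) (e \<nu>) = T g (e \<nu>)"
  by (simp add: linear_on_proj[OF linear_left] e_mem orthonormal if_distrib[of "\<lambda>x. _ * x"] cong: if_cong)

lemma proj_square: "g \<in> S \<Longrightarrow> T (proj N g) (proj N g) = (\<Sum>\<nu>\<in>I \<inter> {..N}. (T g (e \<nu>))\<^sup>2)"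
  by (subst linear_on_proj[OF linear_right[OF proj_mem]])
     (auto intro!: sum.cong simp: proj_coeff power2_eq_square)

lemma proj_defect:
  assumes "g \<in> S"
  shows "(nrm (\<lambda>x. g x - proj N g x))\<^sup>2 = T g g - (\<Sum>\<nu>\<in>I \<inter> {..N}. (T g (e \<nu>))\<^sup>2)"
  using quadratic[OF assms proj_mem[of N g], of 1 "-1"] proj_inner[OF assms, of N] proj_square[OF assms, of N]
  by (simp add: nrm_power2)

lemma bessel: "g \<in> S \<Longrightarrow> (\<Sum>\<nu>\<in>I \<inter> {..N}. (T g (e \<nu>))\<^sup>2) \<le> T g g"
  using proj_defect[of g N] zero_le_power2[of "nrm (\<lambda>x. g x - proj N g x)"] by linarith

lemma nrm_proj_le: "g \<in> S \<Longrightarrow> nrm (proj N g) \<le> nrm g"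
  using bessel[of g N] by (simp add: nrm_def proj_square)

lemma complete_proj: "g \<in> S \<Longrightarrow> (\<lambda>N. nrm (\<lambda>x. g x - proj N g x)) \<longlonglongrightarrow> 0"
  using complete[of g] by (simp add: proj_def)

lemma parseval:
  assumes "g \<in> S"
  shows "(\<lambda>N. \<Sum>\<nu>\<in>I \<inter> {..N}. (T g (e \<nu>))\<^sup>2) \<longlonglongrightarrow> T g g"
proof -
  have "(\<lambda>N. T g g - (nrm (\<lambda>x. g x - proj N g x))\<^sup>2) \<longlonglongrightarrow> T g g - 0\<^sup>2"
    by (intro tendsto_intros complete_proj assms)
  then show ?thesis unfolding proj_defect[OF assms] by simp
qed

lemma nrm_le_of_coeffs:
  assumes g: "g \<in> S" and le: "\<And>N. L2_set (\<lambda>\<nu>. T g (e \<nu>)) (I \<inter> {..N}) \<le> s"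
  shows "nrm g \<le> s"
proof -
  have "0 \<le> s" using le[of 0] L2_set_nonneg order_trans by blast
  have "T g g \<le> s\<^sup>2"
  proof (rule LIMSEQ_le_const2[OF parseval[OF g]])
    have "(\<Sum>\<nu>\<in>I \<inter> {..N}. (T g (e \<nu>))\<^sup>2) \<le> s\<^sup>2" for N
      using power_mono[OF le[of N] L2_set_nonneg, of 2] by (simp add: L2_set_def sum_nonneg)
    then show "\<exists>N. \<forall>n\<ge>N. (\<Sum>\<nu>\<in>I \<inter> {..n}. (T g (e \<nu>))\<^sup>2) \<le> s\<^sup>2" by blast
  qed
  then show ?thesis unfolding nrm_def by (intro real_le_lsqrt nonneg \<open>0 \<le> s\<close>)
qed

text \<open>The operator norm is at most the Hilbert-Schmidt norm. On projections this is
  Cauchy-Schwarz for double sums; the a priori bound \<open>C\<close> only supplies the continuity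
  for letting the truncation level tend to infinity and leaves no trace in the conclusion.\<close>

lemma form_bound_of_coeffs:
  assumes left: "\<And>u. u \<in> S \<Longrightarrow> linear_on (\<lambda>f. B f u)" and right: "\<And>u. u \<in> S \<Longrightarrow> linear_on (B u)"
    and bounded: "\<And>f g. f \<in> S \<Longrightarrow> g \<in> S \<Longrightarrow> \<bar>B f g\<bar> \<le> C * nrm f * nrm g"
    and le: "\<And>N. L2_set (\<lambda>(\<mu>, \<nu>). B (e \<mu>) (e \<nu>)) ((I \<inter> {..N}) \<times> (I \<inter> {..N})) \<le> s"
    and g: "g \<in> S" and u: "u \<in> S"
  shows "\<bar>B g u\<bar> \<le> s * nrm g * nrm u"
proof -
  have s: "0 \<le> s" using le[of 0] L2_set_nonneg order_trans by blast
  have bound: "\<bar>B (proj N g) (proj N u)\<bar> \<le> s * nrm g * nrm u" for N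
  proof -
    let ?F = "I \<inter> {..N}"
    have "B (proj N g) (proj N u) = (\<Sum>\<mu>\<in>?F. T g (e \<mu>) * (\<Sum>\<nu>\<in>?F. T u (e \<nu>) * B (e \<mu>) (e \<nu>)))"
      by (subst linear_on_proj[OF left[OF proj_mem]])
         (auto intro!: sum.cong simp: linear_on_proj[OF right[OF e_mem]])
    also have "\<dots> = (\<Sum>(\<mu>, \<nu>)\<in>?F \<times> ?F. (T g (e \<mu>) * T u (e \<nu>)) * B (e \<mu>) (e \<nu>))"
      by (simp add: sum_distrib_left sum.cartesian_product mult.assoc)
    finally have eq: "B (proj N g) (proj N u)
        = (\<Sum>p\<in>?F \<times> ?F. (\<lambda>(\<mu>, \<nu>). T g (e \<mu>) * T u (e \<nu>)) p * (\<lambda>(\<mu>, \<nu>). B (e \<mu>) (e \<nu>)) p)"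
      by (simp add: case_prod_beta)
    \<comment> \<open>The array of products is itself of rank one, so its norm factors.\<close>
    have "L2_set (\<lambda>(\<mu>, \<nu>). T g (e \<mu>) * T u (e \<nu>)) (?F \<times> ?F) = nrm (proj N g) * nrm (proj N u)"
      unfolding L2_set_def nrm_def proj_square[OF g] proj_square[OF u] real_sqrt_mult[symmetric]
      by (simp add: sum_product sum.cartesian_product case_prod_beta power_mult_distrib)
    also have "\<dots> \<le> nrm g * nrm u"
      by (intro mult_mono nrm_proj_le g u nrm_nonneg)
    finally have "L2_set (\<lambda>(\<mu>, \<nu>). T g (e \<mu>) * T u (e \<nu>)) (?F \<times> ?F)
        * L2_set (\<lambda>(\<mu>, \<nu>). B (e \<mu>) (e \<nu>)) (?F \<times> ?F) \<le> (nrm g * nrm u) * s"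
      by (intro mult_mono le) (auto simp: L2_set_nonneg nrm_nonneg)
    then show ?thesis unfolding eq
      using abs_sum_mult_le_L2_set[of "\<lambda>(\<mu>, \<nu>). T g (e \<mu>) * T u (e \<nu>)" "\<lambda>(\<mu>, \<nu>). B (e \<mu>) (e \<nu>)" "?F \<times> ?F"]
      by (simp add: ac_simps)
  qed
  have near: "\<bar>B g u\<bar> \<le> s * nrm g * nrm u
      + (\<bar>C\<bar> * nrm (\<lambda>x. g x - proj N g x) * nrm u + \<bar>C\<bar> * nrm g * nrm (\<lambda>x. u x - proj N u x))" for N
  proof -
    have gm: "(\<lambda>x. g x - proj N g x) \<in> S" "(\<lambda>x. u x - proj N u x) \<in> S"
      using g u proj_mem diff_mem by blast+
    have "B g u = B (proj N g) (proj N u) + B (\<lambda>x. g x - proj N g x) u + B (proj N g) (\<lambda>x. u x - proj N u x)"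
      using linear_on_diff[OF left[OF u] g proj_mem[of N g]]
        linear_on_diff[OF right[OF proj_mem[of N g]] u proj_mem[of N u]] by simp
    moreover have C: "C * x \<le> \<bar>C\<bar> * x" if "0 \<le> x" for x using that by (simp add: mult_right_mono)
    have "\<bar>B (\<lambda>x. g x - proj N g x) u\<bar> \<le> \<bar>C\<bar> * nrm (\<lambda>x. g x - proj N g x) * nrm u"
      using order_trans[OF bounded[OF gm(1) u]] C[of "nrm (\<lambda>x. g x - proj N g x) * nrm u"] nrm_nonneg
      by (simp add: mult.assoc)
    moreover have "\<bar>B (proj N g) (\<lambda>x. u x - proj N u x)\<bar> \<le> \<bar>C\<bar> * nrm g * nrm (\<lambda>x. u x - proj N u x)"
    proof -
      have "\<bar>B (proj N g) (\<lambda>x. u x - proj N u x)\<bar> \<le> \<bar>C\<bar> * (nrm (proj N g) * nrm (\<lambda>x. u x - proj N u x))"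
        using order_trans[OF bounded[OF proj_mem gm(2)]] C[of "nrm (proj N g) * nrm (\<lambda>x. u x - proj N u x)"] nrm_nonneg
        by (simp add: mult.assoc)
      also have "\<dots> \<le> \<bar>C\<bar> * (nrm g * nrm (\<lambda>x. u x - proj N u x))"
        by (intro mult_left_mono mult_right_mono nrm_proj_le g nrm_nonneg) auto
      finally show ?thesis by (simp add: mult.assoc)
    qed
    ultimately show ?thesis using bound[of N] by linarith
  qed
  have "(\<lambda>N. s * nrm g * nrm u
      + (\<bar>C\<bar> * nrm (\<lambda>x. g x - proj N g x) * nrm u + \<bar>C\<bar> * nrm g * nrm (\<lambda>x. u x - proj N u x)))
      \<longlonglongrightarrow> s * nrm g * nrm u + (\<bar>C\<bar> * 0 * nrm u + \<bar>C\<bar> * nrm g * 0)"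
    by (intro tendsto_intros complete_proj g u)
  then have "\<bar>B g u\<bar> \<le> s * nrm g * nrm u + (\<bar>C\<bar> * 0 * nrm u + \<bar>C\<bar> * nrm g * 0)"
    by (rule LIMSEQ_le_const) (use near in blast)
  then show ?thesis by simp
qed

end

section \<open>The reproducing kernel Hilbert space\<close>

text \<open>The inner product \<open>sinner\<close> with \<open>V01\<close> in place of
  \<open>Vf\<close>. Unlike \<open>sinner\<close>, it is bilinear on all of
  \<open>sobolev m\<close>.\<close>

definition T01 :: "nat \<Rightarrow> real \<Rightarrow> (real \<Rightarrow> real) \<Rightarrow> (real \<Rightarrow> real) \<Rightarrow> real" where
  "T01 m lam f g = V01 f g + lam * Jm m f g"

lemma zero_in_sobolev: "(\<lambda>_. 0) \<in> sobolev m"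
proof -
  have "sob_chain m (\<lambda>_. 0) (\<lambda>_ _. 0)"
    by (auto simp: sob_chain_def abs_cont_on_def set_borel_measurable_def set_integrable_def intro: exI[of _ 1])
  then show ?thesis by (auto simp: sobolev_def)
qed

lemma fun_space_sobolev: "fun_space (sobolev m)"
proof
  show "sobolev m \<noteq> {}" using zero_in_sobolev[of m] by blast
qed (rule sobolev_lincomb)

lemma psd_form_V01: "m \<ge> 1 \<Longrightarrow> psd_form (sobolev m) V01"
  by (intro psd_form.intro fun_space_sobolev psd_form_axioms.intro V01_lincomb_left V01_commute V01_nonneg)

lemma psd_form_Jm: "psd_form (sobolev m) (Jm m)"
  by (intro psd_form.intro fun_space_sobolev psd_form_axioms.intro Jm_lincomb_left Jm_commute Jm_nonneg)

lemma psd_form_T01: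
  assumes "m \<ge> 1" "lam \<ge> 0"
  shows "psd_form (sobolev m) (T01 m lam)"
proof (intro psd_form.intro fun_space_sobolev psd_form_axioms.intro)
  fix f g u :: "real \<Rightarrow> real" and a b :: real
  assume "f \<in> sobolev m" "g \<in> sobolev m" "u \<in> sobolev m"
  then show "T01 m lam (\<lambda>x. a * f x + b * g x) u = a * T01 m lam f u + b * T01 m lam g u"
    using assms by (simp add: T01_def V01_lincomb_left[where m = m] Jm_lincomb_left algebra_simps)
qed (use assms in \<open>simp_all add: T01_def V01_commute Jm_commute V01_nonneg Jm_nonneg\<close>)

lemma T01_cong:
  assumes "\<And>x. x \<in> {0..1} \<Longrightarrow> f x = f' x" "\<And>x. x \<in> {0..1} \<Longrightarrow> g x = g' x"
  shows "T01 m lam f g = T01 m lam f' g'"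
  using V01_cong[OF assms] sobolev_cong(2)[OF assms(1)] sobolev_cong(2)[OF assms(2)]
  by (simp add: T01_def Jm_def)

lemma clip_sobolev: "f \<in> sobolev m \<Longrightarrow> clip f \<in> sobolev m"
  using sobolev_cong(1)[of "clip f" f m] by simp

text \<open>Clipping one argument makes the product vanish outside the unit interval, whatever the
  other argument does there. This carries the kernel and operator hypotheses, stated for
  \<open>sinner\<close>, over to \<open>T01\<close>.\<close>

lemma sinner_clip_right:
  assumes "f \<in> sobolev m" "g \<in> sobolev m" "m \<ge> 1"
  shows "sinner m lam f (clip g) = T01 m lam f g"
proof -
  have "(\<lambda>x. f x * clip g x) = (\<lambda>x. clip f x * clip g x)"
    by (auto simp: fun_eq_iff clip_def indicator_def)
  also have "\<dots> \<in> borel_measurable borel"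
    using clip_measurable assms by (intro borel_measurable_times) auto
  finally have "Vf f (clip g) = V01 f (clip g)" by (rule Vf_eq_V01)
  then have "sinner m lam f (clip g) = T01 m lam f (clip g)" by (simp add: sinner_def T01_def)
  also have "\<dots> = T01 m lam f g" by (rule T01_cong) auto
  finally show ?thesis .
qed

lemma sinner_commute: "sinner m lam f g = sinner m lam g f"
  by (simp add: sinner_def Vf_def Jm_commute mult.commute)

text \<open>The reproducing property is applied to \<open>clip f\<close>, which has the same value
  as \<open>f\<close> at \<open>x\<close>.\<close>

lemma kernel_reproduces:
  assumes "is_repr_kernel m lam K" "x \<in> {0..1}" "f \<in> sobolev m" "m \<ge> 1"
  shows "T01 m lam (K x) f = f x"
proof -
  have "K x \<in> sobolev m" "sinner m lam (K x) (clip f) = clip f x"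
    using assms clip_sobolev unfolding is_repr_kernel_def by blast+
  then show ?thesis using sinner_clip_right[of "K x" m f] assms by simp
qed

lemma P_op_T01:
  assumes "is_P_op m lam P" "f \<in> sobolev m" "g \<in> sobolev m" "m \<ge> 1"
  shows "T01 m lam f (P g) = lam * Jm m f g"
proof -
  have P: "P g \<in> sobolev m" "sinner m lam (clip f) (P g) = lam * Jm m (clip f) g"
    using assms clip_sobolev unfolding is_P_op_def by blast+
  have "sob_deriv m (clip f) = sob_deriv m f" by (rule sobolev_cong) simp
  then have "sinner m lam (clip f) (P g) = lam * Jm m f g" using P(2) by (simp add: Jm_def)
  then show ?thesis
    using sinner_clip_right[OF P(1) assms(2,4), of lam]
    by (simp add: sinner_commute T01_def V01_commute Jm_commute)
qed

text \<open>The default value \<open>0\<close> of \<open>Vf\<close> can only lower the norm, so an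
  upper bound in the \<open>T01\<close> norm implies one for \<open>snorm\<close>.\<close>

lemma snorm_le_T01: "snorm m lam f \<le> sqrt (T01 m lam f f)"
proof -
  have "Vf f f \<le> V01 f f"
    using Vf_eq_V01[of f f] Vf_eq_0[of f f] V01_nonneg[of f] by (cases "(\<lambda>x. f x * f x) \<in> borel_measurable borel") auto
  then show ?thesis by (simp add: snorm_def sinner_def T01_def)
qed

lemma snorm_eq_T01:
  assumes [measurable]: "f \<in> borel_measurable borel"
  shows "snorm m lam f = sqrt (T01 m lam f f)"
  by (simp add: snorm_def sinner_def T01_def Vf_eq_V01)

text \<open>Eventually \<open>\<rho> \<nu>\<close> is at least half of
  \<open>(c * \<nu>)^(2m)\<close>, and 2m \<ge> 2, so the terms are dominated by a multiple of the
  inverse squares. This is what makes the kernel bounded on the diagonal. Index \<open>0\<close> is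
  set to zero because the eigenfunctions are numbered from \<open>1\<close>.\<close>

lemma eigenvalues_summable:
  assumes lim: "(\<lambda>\<nu>. \<rho> \<nu> / (c * real \<nu>) ^ (2 * m)) \<longlonglongrightarrow> 1" and c: "c > 0" and lam: "lam > 0" and m: "m \<ge> 1"
    and nn: "\<And>\<nu>. \<nu> \<ge> 1 \<Longrightarrow> \<rho> \<nu> \<ge> 0"
  shows "summable (\<lambda>\<nu>. if \<nu> = 0 then 0 else 1 / (1 + lam * \<rho> \<nu>))"
proof (rule summable_comparison_test_ev)
  define D where "D = 2 / (lam * c ^ (2 * m))"
  show "summable (\<lambda>\<nu>. D * inverse (real \<nu> ^ 2))"
    by (intro summable_mult inverse_power_summable) simp
  have "eventually (\<lambda>\<nu>. \<rho> \<nu> / (c * real \<nu>) ^ (2 * m) > 1 / 2) sequentially"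
    using lim by (rule order_tendstoD) simp
  then show "eventually (\<lambda>\<nu>. norm (if \<nu> = 0 then 0 else 1 / (1 + lam * \<rho> \<nu>)) \<le> D * inverse (real \<nu> ^ 2)) sequentially"
    using eventually_gt_at_top[of 0]
  proof eventually_elim
    case (elim \<nu>)
    then have \<nu>: "real \<nu> \<ge> 1" by simp
    have pos: "lam * (c ^ (2 * m) * real \<nu> ^ 2) / 2 > 0" using c lam \<nu> by simp
    have "c ^ (2 * m) * real \<nu> ^ 2 \<le> (c * real \<nu>) ^ (2 * m)"
      unfolding power_mult_distrib using c \<nu> m by (intro mult_left_mono power_increasing) auto
    also have "\<dots> \<le> 2 * \<rho> \<nu>" using elim c \<nu> by (simp add: field_simps)
    finally have "lam * (c ^ (2 * m) * real \<nu> ^ 2) \<le> lam * (2 * \<rho> \<nu>)"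
      using lam by (intro mult_left_mono) auto
    then have "lam * (c ^ (2 * m) * real \<nu> ^ 2) / 2 \<le> 1 + lam * \<rho> \<nu>" by simp
    then have "1 / (1 + lam * \<rho> \<nu>) \<le> 1 / (lam * (c ^ (2 * m) * real \<nu> ^ 2) / 2)"
      using pos by (intro divide_left_mono mult_pos_pos) auto
    also have "\<dots> = D * inverse (real \<nu> ^ 2)" by (simp add: D_def field_simps)
    finally show ?case using nn[of \<nu>] lam elim by simp
  qed
qed

text \<open>Nothing forces the eigenfunctions to be measurable outside the unit interval.  Expanding a
  function extended by the constant \<open>1\<close> annihilates, by the junk value of \<^const>\<open>Vf\<close>, exactly the
  coefficients of the non-measurable ones, so the measurable eigenfunctions alone form a basis.\<close>
lemma assumption_A1_expansion:
  assumes A1: "assumption_A1 m lam" and m: "m \<ge> 1" and lam: "lam > 0"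
  obtains I e C g0 where "orthonormal_expansion (sobolev m) (T01 m lam) I e"
    and "\<And>N x. x \<in> {0..1} \<Longrightarrow> (\<Sum>\<nu>\<in>I \<inter> {..N}. (e \<nu> x)\<^sup>2) \<le> C"
    and "g0 \<in> sobolev m" "V01 g0 g0 > 0"
proof -
  from A1[unfolded assumption_A1_def] obtain \<phi> \<rho> c where
    A: "(\<forall>\<nu>\<ge>1. \<phi> \<nu> \<in> sobolev m) \<and> (\<exists>B. \<forall>\<nu>\<ge>1. \<forall>x\<in>{0..1}. \<bar>\<phi> \<nu> x\<bar> \<le> B) \<and>
      (\<forall>\<mu> \<nu>. 1 \<le> \<mu> \<longrightarrow> \<mu> \<le> \<nu> \<longrightarrow> \<rho> \<mu> \<le> \<rho> \<nu>) \<and> c > 0 \<and>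
      ((\<lambda>\<nu>. \<rho> \<nu> / (c * real \<nu>) ^ (2 * m)) \<longlonglongrightarrow> 1) \<and>
      (\<forall>\<mu>\<ge>1. \<forall>\<nu>\<ge>1. Vf (\<phi> \<mu>) (\<phi> \<nu>) = (if \<mu> = \<nu> then 1 else 0)) \<and>
      (\<forall>\<mu>\<ge>1. \<forall>\<nu>\<ge>1. Jm m (\<phi> \<mu>) (\<phi> \<nu>) = (if \<mu> = \<nu> then \<rho> \<mu> else 0)) \<and>
      (\<forall>g\<in>sobolev m.
        (\<lambda>N. snorm m lam (\<lambda>x. g x - (\<Sum>\<nu>=1..N. Vf g (\<phi> \<nu>) * \<phi> \<nu> x))) \<longlonglongrightarrow> 0)"
    by (elim exE)
  note \<phi> = A[THEN conjunct1, rule_format]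
    and c = A[THEN conjunct2, THEN conjunct2, THEN conjunct2, THEN conjunct1, rule_format]
    and lim = A[THEN conjunct2, THEN conjunct2, THEN conjunct2, THEN conjunct2, THEN conjunct1, rule_format]
    and V = A[THEN conjunct2, THEN conjunct2, THEN conjunct2, THEN conjunct2, THEN conjunct2, THEN conjunct1, rule_format]
    and J = A[THEN conjunct2, THEN conjunct2, THEN conjunct2, THEN conjunct2, THEN conjunct2, THEN conjunct2, THEN conjunct1, rule_format]
    and exp = A[THEN conjunct2, THEN conjunct2, THEN conjunct2, THEN conjunct2, THEN conjunct2, THEN conjunct2, THEN conjunct2, rule_format]
  obtain B where B: "\<forall>\<nu>\<ge>1. \<forall>x\<in>{0..1}. \<bar>\<phi> \<nu> x\<bar> \<le> B"
    using A[THEN conjunct2, THEN conjunct1] by (elim exE)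
  note B = B[rule_format]
  interpret psd_form "sobolev m" "T01 m lam" by (rule psd_form_T01) (use m lam in auto)
  define I where "I = {\<nu>. \<nu> \<ge> 1 \<and> \<phi> \<nu> \<in> borel_measurable borel}"
  \<comment> \<open>The squared \<open>T01\<close> norm of the eigenfunction, used to normalise
    it.\<close>
  define \<sigma> where "\<sigma> \<nu> = 1 + lam * \<rho> \<nu>" for \<nu>
  define e where "e \<nu> = (\<lambda>x. (1 / sqrt (\<sigma> \<nu>)) * \<phi> \<nu> x)" for \<nu>
  have \<rho>: "\<rho> \<nu> \<ge> 0" if "\<nu> \<ge> 1" for \<nu> using Jm_nonneg[of m "\<phi> \<nu>"] J[OF that that] by simp
  have \<sigma>: "\<sigma> \<nu> \<ge> 1" if "\<nu> \<ge> 1" for \<nu> using \<rho>[OF that] lam by (simp add: \<sigma>_def)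
  have I: "\<nu> \<ge> 1" "\<phi> \<nu> \<in> borel_measurable borel" if "\<nu> \<in> I" for \<nu> using that by (auto simp: I_def)
  have VI: "V01 (\<phi> \<mu>) (\<phi> \<nu>) = (if \<mu> = \<nu> then 1 else 0)" if "\<mu> \<in> I" "\<nu> \<in> I" for \<mu> \<nu>
    using that V[of \<mu> \<nu>] I Vf_eq_V01[of "\<phi> \<mu>" "\<phi> \<nu>"] by (simp add: borel_measurable_times)
  have T\<phi>: "T01 m lam (\<phi> \<mu>) (\<phi> \<nu>) = (if \<mu> = \<nu> then \<sigma> \<mu> else 0)" if "\<mu> \<in> I" "\<nu> \<in> I" for \<mu> \<nu>
    using VI[OF that] J[OF I(1) I(1), OF that] by (simp add: T01_def \<sigma>_def)
  have e_mem: "e \<nu> \<in> sobolev m" if "\<nu> \<in> I" for \<nu>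
    unfolding e_def using \<phi>[OF I(1)[OF that]] by (rule scale_mem)
  have Te: "T01 m lam g (e \<nu>) = T01 m lam g (\<phi> \<nu>) / sqrt (\<sigma> \<nu>)" if "\<nu> \<in> I" "g \<in> sobolev m" for g \<nu>
    unfolding e_def using linear_on_scale[OF linear_right[OF that(2)] \<phi>[OF I(1)[OF that(1)]], of "1 / sqrt (\<sigma> \<nu>)"] by simp
  have expansion: "(\<lambda>N. nrm (\<lambda>x. g x - (\<Sum>\<nu>\<in>I \<inter> {..N}. V01 g (\<phi> \<nu>) * \<phi> \<nu> x))) \<longlonglongrightarrow> 0"
    if g: "g \<in> sobolev m" for g
  proof -
    define g' where "g' x = (if x \<in> {0..1} then g x else 1)" for x
    have g': "g' \<in> sobolev m" using g sobolev_cong(1)[of g' g m] by (simp add: g'_def)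
    have "g' = (\<lambda>x. clip g x + indicator (- {0..1}) x)" by (auto simp: g'_def fun_eq_iff clip_def indicator_def)
    then have g'm[measurable]: "g' \<in> borel_measurable borel" using clip_measurable[OF g m] by simp
    have coeff: "Vf g' (\<phi> \<nu>) = (if \<nu> \<in> I then V01 g (\<phi> \<nu>) else 0)" if \<nu>: "\<nu> \<ge> 1" for \<nu>
    proof (cases "\<nu> \<in> I")
      case True
      then have "Vf g' (\<phi> \<nu>) = V01 g' (\<phi> \<nu>)" using I(2) g'm by (intro Vf_eq_V01) measurable
      also have "\<dots> = V01 g (\<phi> \<nu>)" by (rule V01_cong) (auto simp: g'_def)
      finally show ?thesis using True by simp
    next
      case False
      have "(\<lambda>x. g' x * \<phi> \<nu> x) \<notin> borel_measurable borel"
      proof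
        assume [measurable]: "(\<lambda>x. g' x * \<phi> \<nu> x) \<in> borel_measurable borel"
        have [measurable]: "clip (\<phi> \<nu>) \<in> borel_measurable borel" using clip_measurable[OF \<phi>[OF \<nu>] m] .
        \<comment> \<open>As \<open>g'\<close> equals \<open>1\<close> outside the unit interval,
          the product recovers the eigenfunction there; inside, its clipped version is already
          measurable.\<close>
        have "\<phi> \<nu> = (\<lambda>x. clip (\<phi> \<nu>) x + indicator (- {0..1}) x * (g' x * \<phi> \<nu> x))"
          by (auto simp: g'_def fun_eq_iff clip_def indicator_def)
        moreover have "\<dots> \<in> borel_measurable borel" by measurable
        ultimately have "\<phi> \<nu> \<in> borel_measurable borel" by metis
        then show False using False \<nu> by (simp add: I_def)
      qed
      then show ?thesis using False by (simp add: Vf_eq_0)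
    qed
    have sum: "(\<Sum>\<nu>=1..N. Vf g' (\<phi> \<nu>) * \<phi> \<nu> x) = (\<Sum>\<nu>\<in>I \<inter> {..N}. V01 g (\<phi> \<nu>) * \<phi> \<nu> x)" for N x
    proof (rule sum.mono_neutral_cong_right)
      show "I \<inter> {..N} \<subseteq> {1..N}" using I(1) by auto
    qed (use I(1) in \<open>auto simp: coeff\<close>)
    have "snorm m lam (\<lambda>x. g' x - (\<Sum>\<nu>=1..N. Vf g' (\<phi> \<nu>) * \<phi> \<nu> x))
        = nrm (\<lambda>x. g x - (\<Sum>\<nu>\<in>I \<inter> {..N}. V01 g (\<phi> \<nu>) * \<phi> \<nu> x))" for N
    proof -
      have "(\<lambda>x. g' x - (\<Sum>\<nu>\<in>I \<inter> {..N}. V01 g (\<phi> \<nu>) * \<phi> \<nu> x)) \<in> borel_measurable borel"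
        using I(2) g'm by (intro borel_measurable_diff borel_measurable_sum borel_measurable_times) auto
      then have "snorm m lam (\<lambda>x. g' x - (\<Sum>\<nu>\<in>I \<inter> {..N}. V01 g (\<phi> \<nu>) * \<phi> \<nu> x))
          = nrm (\<lambda>x. g' x - (\<Sum>\<nu>\<in>I \<inter> {..N}. V01 g (\<phi> \<nu>) * \<phi> \<nu> x))"
        unfolding nrm_def by (rule snorm_eq_T01)
      also have "\<dots> = nrm (\<lambda>x. g x - (\<Sum>\<nu>\<in>I \<inter> {..N}. V01 g (\<phi> \<nu>) * \<phi> \<nu> x))"
        unfolding nrm_def by (intro arg_cong[where f = sqrt] T01_cong) (auto simp: g'_def)
      finally show ?thesis unfolding sum .
    qed
    then show ?thesis using exp[OF g'] by simp
  qed
  \<comment> \<open>Coefficients with respect to \<open>V01\<close> and to \<open>T01\<close> must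
    be matched. Testing the expansion error against the eigenfunction gives a number that is
    constant once \<open>N \<ge> \<nu>\<close>, yet bounded by a null sequence; hence it is
    zero.\<close>
  have coeff: "V01 g (\<phi> \<nu>) * \<phi> \<nu> x = T01 m lam g (e \<nu>) * e \<nu> x" if g: "g \<in> sobolev m" and \<nu>: "\<nu> \<in> I" for g \<nu> x
  proof -
    define SN where "SN N = (\<lambda>x. \<Sum>\<nu>\<in>I \<inter> {..N}. V01 g (\<phi> \<nu>) * \<phi> \<nu> x)" for N
    have SN: "SN N \<in> sobolev m" for N unfolding SN_def by (rule sum_mem) (use \<phi> I in auto)
    have \<phi>\<nu>: "\<phi> \<nu> \<in> sobolev m" using \<phi> I \<nu> by blast
    have const: "T01 m lam (\<lambda>x. g x - SN N x) (\<phi> \<nu>) = T01 m lam g (\<phi> \<nu>) - V01 g (\<phi> \<nu>) * \<sigma> \<nu>" if "N \<ge> \<nu>" for N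
    proof -
      have "T01 m lam (SN N) (\<phi> \<nu>) = (\<Sum>\<mu>\<in>I \<inter> {..N}. V01 g (\<phi> \<mu>) * T01 m lam (\<phi> \<mu>) (\<phi> \<nu>))"
        unfolding SN_def by (rule linear_on_sum[OF linear_left[OF \<phi>\<nu>]]) (use \<phi> I in auto)
      also have "\<dots> = (\<Sum>\<mu>\<in>{\<nu>}. V01 g (\<phi> \<mu>) * T01 m lam (\<phi> \<mu>) (\<phi> \<nu>))"
        by (rule sum.mono_neutral_right) (use \<nu> that T\<phi> in auto)
      also have "\<dots> = V01 g (\<phi> \<nu>) * \<sigma> \<nu>" using T\<phi>[OF \<nu> \<nu>] by simp
      finally show ?thesis using linear_on_diff[OF linear_left[OF \<phi>\<nu>] g SN] by simp
    qed
    have "(\<lambda>N. nrm (\<lambda>x. g x - SN N x) * nrm (\<phi> \<nu>)) \<longlonglongrightarrow> 0 * nrm (\<phi> \<nu>)"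
      using expansion[OF g] unfolding SN_def by (intro tendsto_intros)
    then have "\<bar>T01 m lam g (\<phi> \<nu>) - V01 g (\<phi> \<nu>) * \<sigma> \<nu>\<bar> \<le> 0 * nrm (\<phi> \<nu>)"
    proof (rule LIMSEQ_le_const)
      show "\<exists>N. \<forall>n\<ge>N. \<bar>T01 m lam g (\<phi> \<nu>) - V01 g (\<phi> \<nu>) * \<sigma> \<nu>\<bar> \<le> nrm (\<lambda>x. g x - SN n x) * nrm (\<phi> \<nu>)"
        using abs_le_nrm[OF diff_mem[OF g SN] \<phi>\<nu>] const by (intro exI[of _ \<nu>]) metis
    qed
    then have "T01 m lam g (\<phi> \<nu>) = V01 g (\<phi> \<nu>) * \<sigma> \<nu>" by simp
    then show ?thesis unfolding Te[OF \<nu> g] using \<sigma>[OF I(1)[OF \<nu>]] by (simp add: e_def)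
  qed
  show ?thesis
  proof (rule that)
    show "orthonormal_expansion (sobolev m) (T01 m lam) I e"
    proof
      fix \<mu> \<nu> assume \<mu>\<nu>: "\<mu> \<in> I" "\<nu> \<in> I"
      have "T01 m lam (e \<mu>) (\<phi> \<nu>) = T01 m lam (\<phi> \<mu>) (\<phi> \<nu>) / sqrt (\<sigma> \<mu>)"
        using Te[OF \<mu>\<nu>(1), of "\<phi> \<nu>"] \<phi> I(1) \<mu>\<nu> by (simp add: commute)
      then show "T01 m lam (e \<mu>) (e \<nu>) = (if \<mu> = \<nu> then 1 else 0)"
        using Te[OF \<mu>\<nu>(2) e_mem[OF \<mu>\<nu>(1)]] T\<phi>[OF \<mu>\<nu>] \<sigma>[OF I(1)[OF \<mu>\<nu>(1)]] by (cases "\<mu> = \<nu>") auto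
    next
      fix g assume g: "g \<in> sobolev m"
      show "(\<lambda>N. nrm (\<lambda>x. g x - (\<Sum>\<nu>\<in>I \<inter> {..N}. T01 m lam g (e \<nu>) * e \<nu> x))) \<longlonglongrightarrow> 0"
      proof -
        have "(\<Sum>\<nu>\<in>I \<inter> {..N}. V01 g (\<phi> \<nu>) * \<phi> \<nu> x) = (\<Sum>\<nu>\<in>I \<inter> {..N}. T01 m lam g (e \<nu>) * e \<nu> x)" for N x
          using coeff[OF g] by (intro sum.cong) auto
        then show ?thesis using expansion[OF g] by (simp only:)
      qed
    qed (rule e_mem)
    show "(\<Sum>\<nu>\<in>I \<inter> {..N}. (e \<nu> x)\<^sup>2) \<le> B\<^sup>2 * (\<Sum>\<nu>. if \<nu> = 0 then 0 else 1 / (1 + lam * \<rho> \<nu>))"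
      if x: "x \<in> {0..1}" for N x
    proof -
      let ?a = "\<lambda>\<nu>. if \<nu> = 0 then 0 else 1 / (1 + lam * \<rho> \<nu>)"
      have nn: "0 \<le> ?a \<nu>" for \<nu> using \<rho>[of \<nu>] lam by simp
      have "(\<Sum>\<nu>\<in>I \<inter> {..N}. (e \<nu> x)\<^sup>2) \<le> (\<Sum>\<nu>\<in>I \<inter> {..N}. B\<^sup>2 * ?a \<nu>)"
      proof (rule sum_mono)
        fix \<nu> assume "\<nu> \<in> I \<inter> {..N}"
        then have \<nu>: "\<nu> \<ge> 1" using I(1) by blast
        have "(\<phi> \<nu> x)\<^sup>2 \<le> B\<^sup>2" using B[OF \<nu> x] by (metis abs_ge_zero power2_abs power_mono)
        then show "(e \<nu> x)\<^sup>2 \<le> B\<^sup>2 * ?a \<nu>"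
          using \<sigma>[OF \<nu>] \<nu> by (simp add: e_def power_mult_distrib power_divide \<sigma>_def divide_right_mono)
      qed
      also have "\<dots> = B\<^sup>2 * (\<Sum>\<nu>\<in>I \<inter> {..N}. ?a \<nu>)" by (simp add: sum_distrib_left)
      also have "\<dots> \<le> B\<^sup>2 * (\<Sum>\<nu>. ?a \<nu>)"
        using nn eigenvalues_summable[OF lim c lam m \<rho>] by (intro mult_left_mono sum_le_suminf) auto
      finally show ?thesis .
    qed
    show "\<phi> 1 \<in> sobolev m" by (rule \<phi>) simp
    \<comment> \<open>The hypothesis gives \<open>Vf\<close> the value \<open>1\<close>, which
      excludes the default \<open>0\<close>, so \<open>Vf\<close> and \<open>V01\<close> agree
      here.\<close>
    show "V01 (\<phi> 1) (\<phi> 1) > 0"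
      using V[of 1 1] Vf_eq_V01[of "\<phi> 1" "\<phi> 1"] Vf_eq_0[of "\<phi> 1" "\<phi> 1"]
      by (cases "(\<lambda>x. \<phi> 1 x * \<phi> 1 x) \<in> borel_measurable borel") auto
  qed
qed

section \<open>The remainder of the smoothing spline\<close>

text \<open>Along the line \<open>fh + s * u\<close> the penalised likelihood is a quadratic in
  \<open>s\<close> that is maximal at \<open>s = 0\<close>, so its linear coefficient
  vanishes.\<close>

lemma spline_est_first_order:
  assumes est: "is_spline_est m lam n X Y fh" and u: "u \<in> sobolev m" and n: "n \<ge> 1" and lam: "lam \<ge> 0"
  shows "(1 / real n) * (\<Sum>i<n. (Y i - fh (X i)) * u (X i)) = lam * Jm m fh u"
proof -
  interpret J: psd_form "sobolev m" "Jm m" by (rule psd_form_Jm)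
  have fh: "fh \<in> sobolev m" and max: "\<And>g. g \<in> sobolev m \<Longrightarrow> pen_lik m lam n X Y g \<le> pen_lik m lam n X Y fh"
    using est by (auto simp: is_spline_est_def)
  define L where "L = (1 / real n) * (\<Sum>i<n. (Y i - fh (X i)) * u (X i)) - lam * Jm m fh u"
  define Q where "Q = (1 / (2 * real n)) * (\<Sum>i<n. (u (X i))\<^sup>2) + lam / 2 * Jm m u u"
  have Q: "Q \<ge> 0" unfolding Q_def using lam Jm_nonneg by (intro add_nonneg_nonneg mult_nonneg_nonneg sum_nonneg) auto
  have pen: "pen_lik m lam n X Y (\<lambda>x. 1 * fh x + s * u x) = pen_lik m lam n X Y fh + s * L - s\<^sup>2 * Q" for s
  proof -
    have "(\<Sum>i<n. (Y i - (1 * fh (X i) + s * u (X i)))\<^sup>2)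
        = (\<Sum>i<n. (Y i - fh (X i))\<^sup>2 - 2 * s * ((Y i - fh (X i)) * u (X i)) + s\<^sup>2 * (u (X i))\<^sup>2)"
      by (intro sum.cong) (auto simp: power2_eq_square algebra_simps)
    also have "\<dots> = (\<Sum>i<n. (Y i - fh (X i))\<^sup>2) - 2 * s * (\<Sum>i<n. (Y i - fh (X i)) * u (X i)) + s\<^sup>2 * (\<Sum>i<n. (u (X i))\<^sup>2)"
      by (simp add: sum.distrib sum_subtractf sum_distrib_left)
    finally have eq: "(\<Sum>i<n. (Y i - (1 * fh (X i) + s * u (X i)))\<^sup>2) = \<dots>" .
    have "- (1 / (2 * real n)) * (a1 - 2 * s * a2 + s\<^sup>2 * a3)
        = - (1 / (2 * real n)) * a1 + s * ((1 / real n) * a2) - s\<^sup>2 * ((1 / (2 * real n)) * a3)" for a1 a2 a3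
      using n by (simp add: field_simps)
    then show ?thesis
      unfolding pen_lik_def J.quadratic[OF fh u] L_def Q_def eq by (simp add: right_diff_distrib distrib_left)
  qed
  have le: "s * L \<le> s\<^sup>2 * Q" for s
    using max[OF sobolev_lincomb[OF fh u, of 1 s]] unfolding pen by simp
  \<comment> \<open>Adding \<open>1\<close> avoids dividing by a vanishing \<open>Q\<close>. The
    inequality becomes \<open>s\<^sup>2 * (Q + 1) \<le> s\<^sup>2 * Q\<close> and forces
    \<open>s = 0\<close>.\<close>
  define s where "s = L / (Q + 1)"
  have L: "L = s * (Q + 1)" using Q by (simp add: s_def)
  have "s\<^sup>2 \<le> 0" using le[of s] unfolding L by (simp add: power2_eq_square algebra_simps)
  then show ?thesis using L by (simp add: L_def)
qed

text \<open>The constant \<open>b\<close> bounds the norm of every kernel function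
  \<open>K x\<close>; its value in the application is \<open>c_K / sqrt h\<close>.\<close>

locale spline_rkhs = orthonormal_expansion "sobolev m" "T01 m lam" I e
  for m :: nat and lam :: real and I :: "nat set" and e :: "nat \<Rightarrow> real \<Rightarrow> real" +
  fixes K :: "real \<Rightarrow> real \<Rightarrow> real" and P :: "(real \<Rightarrow> real) \<Rightarrow> (real \<Rightarrow> real)" and b :: real
  assumes m: "m \<ge> 1" and lam: "lam > 0"
    and K: "is_repr_kernel m lam K" and P: "is_P_op m lam P"
    and b: "b \<ge> 0" "\<And>x. x \<in> {0..1} \<Longrightarrow> K x x \<le> b\<^sup>2"
begin

lemma K_mem: "x \<in> {0..1} \<Longrightarrow> K x \<in> sobolev m"
  using K by (simp add: is_repr_kernel_def)

lemma reproducing: "x \<in> {0..1} \<Longrightarrow> f \<in> sobolev m \<Longrightarrow> T01 m lam (K x) f = f x"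
  using kernel_reproduces[OF K] m by blast

lemma nrm_K_le:
  assumes "x \<in> {0..1}"
  shows "nrm (K x) \<le> b"
  unfolding nrm_def reproducing[OF assms K_mem[OF assms]]
  using b assms reproducing[OF assms K_mem[OF assms]] nonneg[of "K x"] by (intro real_le_lsqrt) auto

lemma abs_eval_le: "x \<in> {0..1} \<Longrightarrow> f \<in> sobolev m \<Longrightarrow> \<bar>f x\<bar> \<le> b * nrm f"
  using abs_le_nrm[OF K_mem, of x f] reproducing[of x f] mult_right_mono[OF nrm_K_le[of x] nrm_nonneg[of f]]
  by simp

text \<open>Bessel's inequality for \<open>K x\<close>, whose coefficients are the values
  \<open>e \<nu> x\<close>.\<close>

lemma sum_e_squares_le:
  assumes "x \<in> {0..1}"
  shows "(\<Sum>\<nu>\<in>I \<inter> {..N}. (e \<nu> x)\<^sup>2) \<le> b\<^sup>2"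
proof -
  have "(\<Sum>\<nu>\<in>I \<inter> {..N}. (e \<nu> x)\<^sup>2) = (\<Sum>\<nu>\<in>I \<inter> {..N}. (T01 m lam (K x) (e \<nu>))\<^sup>2)"
    using reproducing[OF assms e_mem] by (intro sum.cong) auto
  also have "\<dots> \<le> b\<^sup>2" using order_trans[OF bessel[OF K_mem[OF assms]]] reproducing[OF assms K_mem[OF assms]] b(2)[OF assms]
    by simp
  finally show ?thesis .
qed

lemma abs_V01_le:
  assumes "f \<in> sobolev m" "g \<in> sobolev m"
  shows "\<bar>V01 f g\<bar> \<le> nrm f * nrm g"
proof -
  interpret V: psd_form "sobolev m" V01 by (rule psd_form_V01[OF m])
  have "V.nrm f \<le> nrm f" for f
    unfolding nrm_def V.nrm_def using lam Jm_nonneg[of m f] by (simp add: T01_def)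
  then show ?thesis
    using order_trans[OF V.abs_le_nrm[OF assms] mult_mono] V.nrm_nonneg nrm_nonneg by blast
qed

lemma P_mem: "f \<in> sobolev m \<Longrightarrow> P f \<in> sobolev m"
  using P by (simp add: is_P_op_def)

text \<open>The bias term. The defining identity of \<open>P\<close> tested with \<open>P f\<close>,
  followed by Cauchy-Schwarz for \<open>Jm\<close>, gives
  \<open>nrm (P f)\<^sup>2 \<le> sqrt lam * nrm (P f)\<close>.\<close>

lemma nrm_P_le:
  assumes f: "f \<in> sobolev m" and J: "Jm m f f \<le> 1"
  shows "nrm (P f) \<le> sqrt lam"
proof -
  interpret J: psd_form "sobolev m" "Jm m" by (rule psd_form_Jm)
  have "(nrm (P f))\<^sup>2 = lam * Jm m (P f) f"
    unfolding nrm_power2 using P_op_T01[OF P P_mem[OF f] f m] .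
  also have "\<dots> \<le> lam * (J.nrm (P f) * J.nrm f)"
    using J.abs_le_nrm[OF P_mem[OF f] f] lam by (intro mult_left_mono) auto
  also have "\<dots> \<le> lam * (J.nrm (P f) * 1)"
    using J lam by (intro mult_left_mono) (auto simp: J.nrm_def Jm_nonneg)
  also have "\<dots> = sqrt lam * sqrt (lam * Jm m (P f) (P f))"
    using lam by (simp add: J.nrm_def real_sqrt_mult)
  also have "\<dots> \<le> sqrt lam * nrm (P f)"
    unfolding nrm_def T01_def using V01_nonneg[of "P f"] lam by (intro mult_left_mono) auto
  finally have "nrm (P f) * nrm (P f) \<le> sqrt lam * nrm (P f)" by (simp add: power2_eq_square)
  then show ?thesis using nrm_nonneg[of "P f"] lam
    by (cases "nrm (P f) = 0") (auto simp: mult_le_cancel_right)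
qed

text \<open>The deterministic core: \<open>s\<close> controls the Hilbert-Schmidt norm of the
  empirical deviation and \<open>w\<close> the norm of the noise, both through finite truncations.
  The remainder reappears on the right because the estimation error is the remainder plus noise
  minus bias.\<close>

lemma remainder_bound:
  fixes X \<epsilon> :: "nat \<Rightarrow> real" and n :: nat and f fh :: "real \<Rightarrow> real"
  defines "B \<equiv> \<lambda>f g. (1 / real n) * (\<Sum>i<n. f (X i) * g (X i)) - V01 f g"
  assumes n: "n \<ge> 1" and X: "\<And>i. i < n \<Longrightarrow> X i \<in> {0..1}"
    and f: "f \<in> sobolev m" and J: "Jm m f f \<le> 1"
    and est: "is_spline_est m lam n X (\<lambda>i. f (X i) + \<epsilon> i) fh"
    and s: "\<And>N. L2_set (\<lambda>(\<mu>, \<nu>). B (e \<mu>) (e \<nu>)) ((I \<inter> {..N}) \<times> (I \<inter> {..N})) \<le> s"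
    and w: "\<And>N. L2_set (\<lambda>\<nu>. (1 / real n) * (\<Sum>i<n. \<epsilon> i * e \<nu> (X i))) (I \<inter> {..N}) \<le> w"
  defines "R \<equiv> \<lambda>x. fh x - f x - ((1 / real n) * (\<Sum>i<n. \<epsilon> i * K (X i) x) - P f x)"
  shows "nrm R \<le> s * (nrm R + (w + sqrt lam))"
proof -
  define noise where "noise = (\<lambda>x. (1 / real n) * (\<Sum>i<n. \<epsilon> i * K (X i) x))"
  define g where "g = (\<lambda>x. fh x - f x)"
  have s0: "0 \<le> s" using s[of 0] L2_set_nonneg order_trans by blast
  have fh: "fh \<in> sobolev m" using est by (simp add: is_spline_est_def)
  have g: "g \<in> sobolev m" unfolding g_def by (rule diff_mem[OF fh f])
  have sumK: "(\<lambda>x. \<Sum>i<n. \<epsilon> i * K (X i) x) \<in> sobolev m"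
    using K_mem X by (intro sum_mem) auto
  have noise: "noise \<in> sobolev m" unfolding noise_def by (rule scale_mem[OF sumK])
  have np: "(\<lambda>x. noise x - P f x) \<in> sobolev m" by (rule diff_mem[OF noise P_mem[OF f]])
  have R_eq: "R = (\<lambda>x. g x - (noise x - P f x))" by (simp add: R_def g_def noise_def)
  have R: "R \<in> sobolev m" unfolding R_eq by (rule diff_mem[OF g np])
  have noise_T: "T01 m lam noise u = (1 / real n) * (\<Sum>i<n. \<epsilon> i * u (X i))" if u: "u \<in> sobolev m" for u
  proof -
    have "T01 m lam noise u = (1 / real n) * T01 m lam (\<lambda>x. \<Sum>i<n. \<epsilon> i * K (X i) x) u"
      unfolding noise_def by (rule linear_on_scale[OF linear_left[OF u] sumK])
    also have "T01 m lam (\<lambda>x. \<Sum>i<n. \<epsilon> i * K (X i) x) u = (\<Sum>i<n. \<epsilon> i * T01 m lam (K (X i)) u)"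
      by (rule linear_on_sum[OF linear_left[OF u]]) (use K_mem X in auto)
    also have "\<dots> = (\<Sum>i<n. \<epsilon> i * u (X i))" using reproducing[OF X u] by (intro sum.cong) auto
    finally show ?thesis .
  qed
  have Jdiff: "Jm m g u = Jm m fh u - Jm m f u" if u: "u \<in> sobolev m" for u
    unfolding g_def using Jm_lincomb_left[OF fh f u, of 1 "-1"] by simp
  \<comment> \<open>The first order condition replaces the residual average by
    \<open>lam * Jm m fh u\<close>; together with the contribution of \<open>P f\<close> the penalty
    terms cancel and only the deviation of the empirical form remains.\<close>
  have R_T: "T01 m lam R u = - B g u" if u: "u \<in> sobolev m" for u
  proof -
    have "T01 m lam R u = T01 m lam g u - (T01 m lam noise u - T01 m lam (P f) u)"
      unfolding R_eq linear_on_diff[OF linear_left[OF u] g np]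
        linear_on_diff[OF linear_left[OF u] noise P_mem[OF f]] ..
    also have "T01 m lam (P f) u = lam * Jm m f u"
      using P_op_T01[OF P u f m] by (simp add: commute Jm_commute)
    also have "T01 m lam noise u = (1 / real n) * (\<Sum>i<n. (f (X i) + \<epsilon> i - fh (X i)) * u (X i))
        + (1 / real n) * (\<Sum>i<n. g (X i) * u (X i))"
      unfolding noise_T[OF u] distrib_left[symmetric] sum.distrib[symmetric]
      by (simp add: g_def algebra_simps)
    also have "(1 / real n) * (\<Sum>i<n. (f (X i) + \<epsilon> i - fh (X i)) * u (X i)) = lam * Jm m fh u"
      using spline_est_first_order[OF est u n] lam by simp
    finally show ?thesis by (simp add: B_def T01_def Jdiff[OF u] algebra_simps)
  qed
  have lin_l: "linear_on (\<lambda>f. B f u)" if u: "u \<in> sobolev m" for u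
    unfolding linear_on_def B_def using V01_lincomb_left[OF _ _ u m]
    by (simp add: sum.distrib sum_distrib_left algebra_simps)
  have B_comm: "B f g = B g f" for f g by (simp add: B_def V01_commute mult.commute)
  have lin_r: "linear_on (B u)" if u: "u \<in> sobolev m" for u
  proof -
    have "B u = (\<lambda>f. B f u)" using B_comm by blast
    then show ?thesis using lin_l[OF u] by simp
  qed
  have bounded: "\<bar>B f g\<bar> \<le> (b\<^sup>2 + 1) * nrm f * nrm g" if f: "f \<in> sobolev m" and g: "g \<in> sobolev m" for f g
  proof -
    have "\<bar>\<Sum>i<n. f (X i) * g (X i)\<bar> \<le> (\<Sum>i<n. (b * nrm f) * (b * nrm g))"
    proof (rule order_trans[OF sum_abs sum_mono])
      fix i assume "i \<in> {..<n}"
      then show "\<bar>f (X i) * g (X i)\<bar> \<le> (b * nrm f) * (b * nrm g)"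
        unfolding abs_mult using X b(1) nrm_nonneg by (intro mult_mono abs_eval_le f g) auto
    qed
    then have "\<bar>(1 / real n) * (\<Sum>i<n. f (X i) * g (X i))\<bar> \<le> b\<^sup>2 * (nrm f * nrm g)"
      using n by (simp add: abs_mult field_simps power2_eq_square)
    moreover have "(b\<^sup>2 + 1) * nrm f * nrm g = b\<^sup>2 * (nrm f * nrm g) + nrm f * nrm g"
      by (simp add: algebra_simps)
    ultimately show ?thesis
      using abs_V01_le[OF f g] abs_triangle_ineq4[of "(1 / real n) * (\<Sum>i<n. f (X i) * g (X i))" "V01 f g"]
      unfolding B_def by linarith
  qed
  \<comment> \<open>The remainder is tested against itself.\<close>
  have "nrm R * nrm R = - B g R" using R_T[OF R] nrm_power2[of R] by (simp add: power2_eq_square)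
  also have "\<dots> \<le> s * nrm g * nrm R"
    using form_bound_of_coeffs[where B = B and C = "b\<^sup>2 + 1" and s = s, OF lin_l lin_r bounded s g R] by (simp add: abs_le_iff)
  finally have Rg: "nrm R \<le> s * nrm g"
    using s0 nrm_nonneg[of g] nrm_nonneg[of R] by (cases "nrm R = 0") (auto simp: mult_le_cancel_right)
  have "nrm noise \<le> w"
  proof (rule nrm_le_of_coeffs[OF noise])
    fix N
    have "L2_set (\<lambda>\<nu>. T01 m lam noise (e \<nu>)) (I \<inter> {..N})
        = L2_set (\<lambda>\<nu>. (1 / real n) * (\<Sum>i<n. \<epsilon> i * e \<nu> (X i))) (I \<inter> {..N})"
      by (rule L2_set_cong) (auto simp: noise_T e_mem)
    then show "L2_set (\<lambda>\<nu>. T01 m lam noise (e \<nu>)) (I \<inter> {..N}) \<le> w" using w by simp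
  qed
  moreover have "nrm (\<lambda>x. noise x - P f x) \<le> nrm noise + nrm (P f)"
  proof -
    have neg: "(\<lambda>x. - 1 * P f x) \<in> sobolev m" by (rule scale_mem[OF P_mem[OF f]])
    have "nrm (\<lambda>x. - 1 * P f x) = nrm (P f)"
      using quadratic[OF P_mem[OF f] P_mem[OF f], of "-1" 0] by (simp add: nrm_def)
    then show ?thesis using nrm_triangle[OF noise neg] by simp
  qed
  moreover have "nrm g \<le> nrm R + nrm (\<lambda>x. noise x - P f x)"
    using nrm_triangle[OF R np] by (simp add: R_eq)
  ultimately have "nrm g \<le> nrm R + (w + sqrt lam)" using nrm_P_le[OF f J] by linarith
  then show ?thesis using Rg mult_left_mono[OF _ s0] order_trans by blast
qed

end

text \<open>The last summand alone suffices: its root is at least \<open>sqrt (ln 2)\<close>, hence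
  at least \<open>tau\<close>, which leaves \<open>40 * sqrt 6\<close>.\<close>

lemma A_fun_ge:
  assumes "c0 > 0" "cK > 0" "h > 0"
  shows "A_fun m c0 cK h 2 \<ge> 32"
proof -
  have tau: "tau > 0" by (simp add: tau_def)
  \<comment> \<open>A nonintegrable integrand would give the default value \<open>0\<close>, so both
    cases are nonnegative.\<close>
  have Psi: "Psi m r \<ge> 0" for r
  proof (cases "(\<lambda>x. sqrt (ln (1 + exp (x powr (- 1 / real m))))) integrable_on {0..r}")
    case True
    then show ?thesis unfolding Psi_def by (intro Henstock_Kurzweil_Integration.integral_nonneg) auto
  next
    case False
    then show ?thesis unfolding Psi_def by (simp add: not_integrable_integral)
  qed
  define z where "z = 2 * c0 * (cK * h powr ((2 * real m - 1) / 2) * 2) powr (- 1 / real m)"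
  have "z \<ge> 0" using assms by (simp add: z_def)
  then have "exp z \<ge> 1" by simp
  then have "ln (3 / 2) \<le> ln (1 + exp z)" using ln_mono[of "3 / 2" "1 + exp z"] by linarith
  then have "tau \<le> sqrt (ln (1 + exp z))" unfolding tau_def by simp
  then have "20 * sqrt 6 * 2 / tau * tau \<le> 20 * sqrt 6 * 2 / tau * sqrt (ln (1 + exp z))"
    using tau by (intro mult_left_mono) auto
  moreover have "sqrt 6 \<ge> (1::real)" by simp
  then have "20 * sqrt 6 * 2 / tau * tau \<ge> 32" using tau by (simp del: real_sqrt_ge_1_iff)
  moreover have "0 \<le> 32 * sqrt 6 / tau * (1 / cK) * c0 ^ m * h powr (- (2 * real m - 1) / 2) *
       Psi m (1/2 * cK * (1 / c0 ^ m) * h powr ((2 * real m - 1) / 2) * 2)"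
    using assms tau Psi by (intro mult_nonneg_nonneg) auto
  ultimately show ?thesis unfolding A_fun_def z_def[symmetric] by linarith
qed

text \<open>The supremum in \<open>c_K\<close> bounds its members only once the set is known to be
  bounded above; Parseval's identity for \<open>K x\<close> and the uniform bound on the squared
  basis functions provide this.\<close>

lemma kernel_sup_bound:
  assumes A1: "assumption_A1 m lam" and K: "is_repr_kernel m lam K"
    and m: "m \<ge> 1" and h: "h > 0" and lam: "lam > 0"
  obtains I e where "orthonormal_expansion (sobolev m) (T01 m lam) I e"
    and "\<And>x. x \<in> {0..1} \<Longrightarrow> K x x \<le> (c_K h K)\<^sup>2 / h" and "c_K h K > 0"
proof -
  obtain I e C g where exp: "orthonormal_expansion (sobolev m) (T01 m lam) I e"
    and C: "\<And>N x. x \<in> {0..1} \<Longrightarrow> (\<Sum>\<nu>\<in>I \<inter> {..N}. (e \<nu> x)\<^sup>2) \<le> C"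
    and g: "g \<in> sobolev m" "V01 g g > 0"
    using assumption_A1_expansion[OF A1 m lam] by metis
  interpret orthonormal_expansion "sobolev m" "T01 m lam" I e by (rule exp)
  have Kx: "K x \<in> sobolev m" if "x \<in> {0..1}" for x using K that by (simp add: is_repr_kernel_def)
  have rep: "T01 m lam (K x) f = f x" if "x \<in> {0..1}" "f \<in> sobolev m" for x f
    using kernel_reproduces[OF K that m] .
  have K0: "0 \<le> K x x" if "x \<in> {0..1}" for x using nonneg[of "K x"] rep[OF that Kx[OF that]] by simp
  have KC: "K x x \<le> C" if x: "x \<in> {0..1}" for x
  proof -
    have "T01 m lam (K x) (K x) \<le> C"
    proof (rule LIMSEQ_le_const2[OF parseval[OF Kx[OF x]]])
      have "(\<Sum>\<nu>\<in>I \<inter> {..N}. (T01 m lam (K x) (e \<nu>))\<^sup>2) = (\<Sum>\<nu>\<in>I \<inter> {..N}. (e \<nu> x)\<^sup>2)" for N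
        using rep[OF x e_mem] by (intro sum.cong) auto
      then show "\<exists>N. \<forall>n\<ge>N. (\<Sum>\<nu>\<in>I \<inter> {..n}. (T01 m lam (K x) (e \<nu>))\<^sup>2) \<le> C" using C[OF x] by simp
    qed
    then show ?thesis using rep[OF x Kx[OF x]] by simp
  qed
  have bdd: "bdd_above ((\<lambda>x. sqrt (h * K x x)) ` {0..1})"
    using KC h by (intro bdd_aboveI[of _ "sqrt (h * C)"]) auto
  have le: "sqrt (h * K x x) \<le> c_K h K" if "x \<in> {0..1}" for x
    unfolding c_K_def using that by (intro cSUP_upper bdd)
  have bound: "K x x \<le> (c_K h K)\<^sup>2 / h" if x: "x \<in> {0..1}" for x
  proof -
    have "(sqrt (h * K x x))\<^sup>2 \<le> (c_K h K)\<^sup>2"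
      using le[OF x] h K0[OF x] by (intro power_mono) auto
    then show ?thesis using h K0[OF x] by (simp add: field_simps)
  qed
  have "\<exists>x\<in>{0..1}. g x \<noteq> 0"
  proof (rule ccontr)
    assume "\<not> ?thesis"
    then have "clip g = (\<lambda>_. 0)" by (auto simp: clip_def fun_eq_iff indicator_def)
    then show False using g(2) by (simp add: V01_def)
  qed
  then obtain x where x: "x \<in> {0..1}" "g x \<noteq> 0" by blast
  \<comment> \<open>If \<open>K x x\<close> vanished, Cauchy-Schwarz would make every function of
    the space vanish at \<open>x\<close>.\<close>
  have "K x x \<noteq> 0"
    using cauchy_schwarz[OF Kx[OF x(1)] g(1)] rep[OF x(1) g(1)] rep[OF x(1) Kx[OF x(1)]] x(2) by auto
  then have "sqrt (h * K x x) > 0" using K0[OF x(1)] h by simp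
  then have "c_K h K > 0" using le[OF x(1)] by linarith
  with exp bound show ?thesis by (rule that)
qed

section \<open>The random sample\<close>

lemma prob_space_uniform: "prob_space (uniform_measure lborel {0..1::real})"
  by (rule prob_space_uniform_measure) auto

lemma prob_space_observation:
  "prob_space (uniform_measure lborel {0..1::real} \<Otimes>\<^sub>M density lborel std_normal_density)"
proof -
  interpret U: prob_space "uniform_measure lborel {0..1::real}" by (rule prob_space_uniform)
  interpret G: prob_space "density lborel std_normal_density" by (rule prob_space_normal_density) simp
  interpret pair_prob_space "uniform_measure lborel {0..1::real}" "density lborel std_normal_density" ..
  show ?thesis by unfold_locales
qed

text \<open>The uniform measure lives on all reals, so design points lie in the unit interval only
  almost surely, whereas the kernel identities require it surely.\<close>

lemma AE_sample_in_unit_interval: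
  "AE \<omega> in sample_space n. \<forall>i<n. fst (\<omega> i) \<in> {0..1}"
proof -
  let ?U = "uniform_measure lborel {0..1::real}" and ?G = "density lborel std_normal_density"
  interpret G: prob_space ?G by (rule prob_space_normal_density) simp
  have "AE x in ?U. x \<in> {0..1}" by (rule AE_uniform_measureI) auto
  then have "AE x in distr (?U \<Otimes>\<^sub>M ?G) ?U fst. x \<in> {0..1}" by (simp only: G.distr_pair_fst)
  then have "AE z in ?U \<Otimes>\<^sub>M ?G. fst z \<in> {0..1}" by (rule AE_distrD[rotated]) (rule measurable_fst)
  then have "AE \<omega> in sample_space n. fst (\<omega> i) \<in> {0..1}" if "i < n" for i
    unfolding sample_space_def using that by (intro AE_PiM_component prob_space_observation) auto
  then have "AE \<omega> in sample_space n. \<forall>i\<in>{..<n}. fst (\<omega> i) \<in> {0..1}"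
    by (subst AE_finite_all) auto
  then show ?thesis by (simp add: Ball_def)
qed

context spline_rkhs
begin

text \<open>The coordinates of the rank-one operator at \<open>x\<close>. Clipping makes them Borel
  measurable and bounded at every real \<open>x\<close>, as the moment bounds demand.\<close>

definition tensor :: "real \<Rightarrow> nat \<times> nat \<Rightarrow> real" where
  "tensor x = (\<lambda>(\<mu>, \<nu>). clip (e \<mu>) x * clip (e \<nu>) x)"

definition tensor_mean :: "nat \<times> nat \<Rightarrow> real" where
  "tensor_mean = (\<lambda>(\<mu>, \<nu>). V01 (e \<mu>) (e \<nu>))"

definition square_index :: "nat \<Rightarrow> (nat \<times> nat) set" where
  "square_index N = (I \<inter> {..N}) \<times> (I \<inter> {..N})"

lemma sum_clip_e_le: "(\<Sum>\<nu>\<in>I \<inter> {..N}. (clip (e \<nu>) x)\<^sup>2) \<le> b\<^sup>2"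
  using sum_e_squares_le[of x N] by (cases "x \<in> {0..1}") (simp_all add: clip_def)

lemma L2_set_clip_e_le: "L2_set (\<lambda>\<nu>. clip (e \<nu>) x) (I \<inter> {..N}) \<le> b"
  unfolding L2_set_def using sum_clip_e_le b(1) by (intro real_le_lsqrt sum_nonneg) auto

lemma L2_set_tensor_le: "L2_set (tensor x) (square_index N) \<le> b\<^sup>2"
proof -
  have "(\<Sum>p\<in>square_index N. (tensor x p)\<^sup>2) = (\<Sum>\<nu>\<in>I \<inter> {..N}. (clip (e \<nu>) x)\<^sup>2)\<^sup>2"
    unfolding square_index_def tensor_def power2_eq_square[of "sum _ _"]
    by (simp add: sum_product sum.cartesian_product case_prod_beta power_mult_distrib)
  then have "L2_set (tensor x) (square_index N) = (\<Sum>\<nu>\<in>I \<inter> {..N}. (clip (e \<nu>) x)\<^sup>2)"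
    unfolding L2_set_def by (simp add: sum_nonneg)
  then show ?thesis using sum_clip_e_le by simp
qed

lemma tensor_integrable:
  assumes "p \<in> square_index N"
  shows "integrable lborel (\<lambda>x. tensor x p)" "(LINT x|lborel. tensor x p) = tensor_mean p"
  using assms V01_integrable[OF e_mem e_mem m]
  by (auto simp: square_index_def tensor_def tensor_mean_def V01_def)

text \<open>The norm of a mean is at most the mean of the norms. The mean is paired with itself and
  one copy is written as an integral, so that Cauchy-Schwarz applies pointwise.\<close>

lemma L2_set_tensor_mean_le: "L2_set tensor_mean (square_index N) \<le> b\<^sup>2"
proof -
  let ?F = "square_index N" and ?L = "L2_set tensor_mean (square_index N)"
  have "?L * ?L = (\<Sum>p\<in>?F. tensor_mean p * tensor_mean p)"
    unfolding L2_set_def by (simp add: sum_nonneg power2_eq_square)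
  also have "\<dots> = (\<Sum>p\<in>?F. tensor_mean p * (LINT x|lborel. tensor x p))"
    using tensor_integrable(2) by (intro sum.cong) auto
  also have "\<dots> = (LINT x|lborel. (\<Sum>p\<in>?F. tensor_mean p * tensor x p))"
    using tensor_integrable(1) by (simp add: Bochner_Integration.integral_sum)
  also have "\<dots> \<le> (LINT x|lborel. (?L * b\<^sup>2 * indicator {0..1::real} x))"
  proof (rule integral_mono)
    show "integrable lborel (\<lambda>x. \<Sum>p\<in>?F. tensor_mean p * tensor x p)"
      using tensor_integrable(1) by (intro Bochner_Integration.integrable_sum integrable_mult_right) auto
    show "integrable lborel (\<lambda>x. ?L * b\<^sup>2 * indicator {0..1::real} x)"
      by (intro integrable_mult_right integrable_real_indicator) auto
    fix x :: real
    show "(\<Sum>p\<in>?F. tensor_mean p * tensor x p) \<le> ?L * b\<^sup>2 * indicator {0..1} x"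
    proof (cases "x \<in> {0..1}")
      case True
      have "(\<Sum>p\<in>?F. tensor_mean p * tensor x p) \<le> ?L * L2_set (tensor x) ?F"
        using abs_sum_mult_le_L2_set[of tensor_mean "tensor x" ?F] by simp
      also have "\<dots> \<le> ?L * b\<^sup>2" by (intro mult_left_mono L2_set_tensor_le L2_set_nonneg)
      finally show ?thesis using True by simp
    next
      case False
      then show ?thesis by (simp add: tensor_def clip_def case_prod_beta)
    qed
  qed
  also have "\<dots> = ?L * b\<^sup>2" by simp
  finally show ?thesis using L2_set_nonneg[of tensor_mean ?F]
    by (cases "?L = 0") (auto simp: mult_le_cancel_left)
qed

lemma clip_e_measurable: "\<nu> \<in> I \<Longrightarrow> clip (e \<nu>) \<in> borel_measurable borel"
  using clip_measurable[OF e_mem m] .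

text \<open>A summand and its mean each have norm at most \<open>b\<^sup>2\<close>, so the centred
  summand is bounded by \<open>2 * b\<^sup>2\<close>.\<close>

lemma tensor_deviation_tail:
  fixes n :: nat
  assumes n: "n \<ge> 1" and y: "y \<ge> 0" and b0: "b > 0"
  defines "E \<equiv> {\<omega> \<in> space (sample_space n).
      \<exists>N. L2_set (\<lambda>p. \<Sum>j<n. tensor (fst (\<omega> j)) p - tensor_mean p) (square_index N) > y}"
  shows "E \<in> sets (sample_space n)"
    and "measure (sample_space n) E \<le> 2 * exp (- (y\<^sup>2 / (4 * n * (2 * b\<^sup>2)\<^sup>2)))"
proof -
  let ?U = "uniform_measure lborel {0..1::real}" and ?G = "density lborel std_normal_density"
  let ?N = "?U \<Otimes>\<^sub>M ?G"
  interpret U: prob_space ?U by (rule prob_space_uniform)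
  interpret G: prob_space ?G by (rule prob_space_normal_density) simp
  define \<xi> where "\<xi> = (\<lambda>(z :: real \<times> real) p. tensor (fst z) p - tensor_mean p)"
  have tm: "(\<lambda>x. tensor x p - tensor_mean p) \<in> borel_measurable borel" if "p \<in> square_index k" for p k
    using that clip_e_measurable by (auto simp: tensor_def square_index_def)
  have meas: "(\<lambda>z. \<xi> z p) \<in> borel_measurable ?N" if "p \<in> square_index k" for p k
    unfolding \<xi>_def using measurable_compose[OF measurable_fst, of "\<lambda>x. tensor x p - tensor_mean p" ?U borel ?G] tm[OF that]
    by simp
  have zero: "(\<integral>z. \<xi> z p \<partial>?N) = 0" if p: "p \<in> square_index k" for p k
  proof -
    have "(\<integral>z. \<xi> z p \<partial>?N) = (\<integral>x. tensor x p - tensor_mean p \<partial>distr ?N ?U fst)"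
      unfolding \<xi>_def using tm[OF p] by (subst integral_distr) auto
    also have "\<dots> = (LINT x|lborel. indicator {0..1} x * (tensor x p - tensor_mean p))"
      unfolding G.distr_pair_fst by (rule integral_uniform_unit_interval[OF tm[OF p]])
    also have "\<dots> = (LINT x|lborel. (tensor x p - tensor_mean p * indicator {0..1::real} x))"
      by (intro Bochner_Integration.integral_cong)
         (auto simp: tensor_def clip_def case_prod_beta indicator_def)
    also have "\<dots> = 0"
      using tensor_integrable[OF p]
      by (subst Bochner_Integration.integral_diff) (auto intro!: integrable_mult_right integrable_real_indicator)
    finally show ?thesis .
  qed
  have bd: "L2_set (\<xi> z) (square_index k) \<le> 2 * b\<^sup>2" for z k
  proof -
    have "L2_set (\<lambda>p. - tensor_mean p) (square_index k) = L2_set tensor_mean (square_index k)"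
      by (simp add: L2_set_def)
    then show ?thesis
      using L2_set_triangle_ineq[of "tensor (fst z)" "\<lambda>p. - tensor_mean p" "square_index k"]
        L2_set_tensor_le[of "fst z" k] L2_set_tensor_mean_le[of k]
      by (simp add: \<xi>_def)
  qed
  have fin: "finite (square_index k)" "square_index k \<subseteq> square_index (Suc k)" for k
    by (auto simp: square_index_def)
  have E: "E = {\<omega> \<in> space (PiM {..<n} (\<lambda>_. ?N)). \<exists>k. L2_set (\<lambda>p. \<Sum>j<n. \<xi> (\<omega> j) p) (square_index k) > y}"
    by (simp add: E_def \<xi>_def sample_space_def)
  have b2: "(2 * b\<^sup>2)\<^sup>2 > 0" using b0 by simp
  have step: "(\<integral>\<^sup>+z. ennreal (cosh (L2_set (\<lambda>i. s i + \<theta> * \<xi> z i) (square_index k))) \<partial>?N)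
      \<le> ennreal (exp ((2 * b\<^sup>2)\<^sup>2 * \<theta>\<^sup>2)) * ennreal (cosh (L2_set s (square_index k)))" for k \<theta> s
    by (rule nn_integral_cosh_scaled_centred_le[OF prob_space_observation fin(1) meas zero bd])
  note tail = measure_PiM_sum_exceeds_le[where \<xi> = \<xi> and F = square_index,
      OF prob_space_observation n b2 y fin meas step]
  show "E \<in> sets (sample_space n)" unfolding E sample_space_def by (rule tail(2))
  show "measure (sample_space n) E \<le> 2 * exp (- (y\<^sup>2 / (4 * n * (2 * b\<^sup>2)\<^sup>2)))"
    unfolding E sample_space_def by (rule tail(1))
qed

text \<open>The variance proxy \<open>b\<^sup>2 / 2\<close> comes from the Gaussian moment bound,
  given the design point.\<close>

lemma noise_tail:
  fixes n :: nat
  assumes n: "n \<ge> 1" and y: "y \<ge> 0" and b0: "b > 0"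
  defines "E \<equiv> {\<omega> \<in> space (sample_space n).
      \<exists>N. L2_set (\<lambda>\<nu>. \<Sum>j<n. snd (\<omega> j) * clip (e \<nu>) (fst (\<omega> j))) (I \<inter> {..N}) > y}"
  shows "E \<in> sets (sample_space n)"
    and "measure (sample_space n) E \<le> 2 * exp (- (y\<^sup>2 / (4 * n * (b\<^sup>2 / 2))))"
proof -
  let ?U = "uniform_measure lborel {0..1::real}" and ?G = "density lborel std_normal_density"
  let ?N = "?U \<Otimes>\<^sub>M ?G"
  define \<xi> where "\<xi> = (\<lambda>(z :: real \<times> real) \<nu>. snd z * clip (e \<nu>) (fst z))"
  have km: "(\<lambda>x. clip (e \<nu>) x) \<in> borel_measurable ?U" if "\<nu> \<in> I \<inter> {..k}" for \<nu> k
    using that clip_e_measurable[of \<nu>] by simp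
  have meas: "(\<lambda>z. \<xi> z \<nu>) \<in> borel_measurable ?N" if \<nu>: "\<nu> \<in> I \<inter> {..k}" for \<nu> k
  proof -
    have "snd \<in> borel_measurable ?N" using measurable_snd[of ?U ?G] by (simp add: measurable_def)
    then show ?thesis unfolding \<xi>_def
      using measurable_compose[OF measurable_fst km[OF \<nu>]] by (intro borel_measurable_times) auto
  qed
  have fin: "finite (I \<inter> {..k})" "I \<inter> {..k} \<subseteq> I \<inter> {..Suc k}" for k by auto
  have E: "E = {\<omega> \<in> space (PiM {..<n} (\<lambda>_. ?N)). \<exists>k. L2_set (\<lambda>\<nu>. \<Sum>j<n. \<xi> (\<omega> j) \<nu>) (I \<inter> {..k}) > y}"
    by (simp add: E_def \<xi>_def sample_space_def)
  have b2: "b\<^sup>2 / 2 > 0" using b0 by simp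
  have step: "(\<integral>\<^sup>+z. ennreal (cosh (L2_set (\<lambda>i. s i + \<theta> * \<xi> z i) (I \<inter> {..k}))) \<partial>?N)
      \<le> ennreal (exp (b\<^sup>2 / 2 * \<theta>\<^sup>2)) * ennreal (cosh (L2_set s (I \<inter> {..k})))" for k \<theta> s
    unfolding \<xi>_def by (rule nn_integral_cosh_scaled_normal_le[OF prob_space_uniform fin(1) km L2_set_clip_e_le])
  note tail = measure_PiM_sum_exceeds_le[where \<xi> = \<xi> and F = "\<lambda>k. I \<inter> {..k}",
      OF prob_space_observation n b2 y fin meas step]
  show "E \<in> sets (sample_space n)" unfolding E sample_space_def by (rule tail(2))
  show "measure (sample_space n) E \<le> 2 * exp (- (y\<^sup>2 / (4 * n * (b\<^sup>2 / 2))))"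
    unfolding E sample_space_def by (rule tail(1))
qed

lemma remainder_bound_off_events:
  fixes n :: nat and f fh :: "real \<Rightarrow> real" and \<omega> :: "nat \<Rightarrow> real \<times> real" and s w :: real
  assumes n: "n \<ge> 1" and X: "\<And>i. i < n \<Longrightarrow> fst (\<omega> i) \<in> {0..1}"
    and f: "f \<in> sobolev m" "Jm m f f \<le> 1"
    and est: "is_spline_est m lam n (\<lambda>i. fst (\<omega> i)) (\<lambda>i. f (fst (\<omega> i)) + snd (\<omega> i)) fh"
    and s: "\<And>N. L2_set (\<lambda>p. \<Sum>j<n. tensor (fst (\<omega> j)) p - tensor_mean p) (square_index N) \<le> n * s"
    and w: "\<And>N. L2_set (\<lambda>\<nu>. \<Sum>j<n. snd (\<omega> j) * clip (e \<nu>) (fst (\<omega> j))) (I \<inter> {..N}) \<le> n * w"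
  defines "R \<equiv> \<lambda>x. fh x - f x - ((1 / real n) * (\<Sum>i<n. snd (\<omega> i) * K (fst (\<omega> i)) x) - P f x)"
  shows "nrm R \<le> s * (nrm R + (w + sqrt lam))"
  unfolding R_def
proof (rule remainder_bound[OF n X f est])
  fix N
  have "L2_set (\<lambda>(\<mu>, \<nu>). (1 / real n) * (\<Sum>i<n. e \<mu> (fst (\<omega> i)) * e \<nu> (fst (\<omega> i))) - V01 (e \<mu>) (e \<nu>))
        ((I \<inter> {..N}) \<times> (I \<inter> {..N}))
      = L2_set (\<lambda>p. (1 / real n) * (\<Sum>j<n. tensor (fst (\<omega> j)) p - tensor_mean p)) (square_index N)"
    unfolding square_index_def using n X
    by (intro L2_set_cong) (auto simp: tensor_def tensor_mean_def sum_subtractf field_simps)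
  also have "\<dots> = (1 / real n) * L2_set (\<lambda>p. \<Sum>j<n. tensor (fst (\<omega> j)) p - tensor_mean p) (square_index N)"
    by (rule L2_set_right_distrib[symmetric]) simp
  also have "\<dots> \<le> s" using s[of N] n by (simp add: field_simps)
  finally show "L2_set (\<lambda>(\<mu>, \<nu>). (1 / real n) * (\<Sum>i<n. e \<mu> (fst (\<omega> i)) * e \<nu> (fst (\<omega> i))) - V01 (e \<mu>) (e \<nu>))
        ((I \<inter> {..N}) \<times> (I \<inter> {..N})) \<le> s" .
  have "L2_set (\<lambda>\<nu>. (1 / real n) * (\<Sum>i<n. snd (\<omega> i) * e \<nu> (fst (\<omega> i)))) (I \<inter> {..N})
      = L2_set (\<lambda>\<nu>. (1 / real n) * (\<Sum>j<n. snd (\<omega> j) * clip (e \<nu>) (fst (\<omega> j)))) (I \<inter> {..N})"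
    using X by (intro L2_set_cong) auto
  also have "\<dots> = (1 / real n) * L2_set (\<lambda>\<nu>. \<Sum>j<n. snd (\<omega> j) * clip (e \<nu>) (fst (\<omega> j))) (I \<inter> {..N})"
    by (rule L2_set_right_distrib[symmetric]) simp
  also have "\<dots> \<le> w" using w[of N] n by (simp add: field_simps)
  finally show "L2_set (\<lambda>\<nu>. (1 / real n) * (\<Sum>i<n. snd (\<omega> i) * e \<nu> (fst (\<omega> i)))) (I \<inter> {..N}) \<le> w" .
qed

end

theorem theorem3p4:
  fixes m n :: nat and h r M c0 :: real
    and K :: "real \<Rightarrow> real \<Rightarrow> real"
    and P :: "(real \<Rightarrow> real) \<Rightarrow> (real \<Rightarrow> real)"
  assumes m: "m \<ge> 1" and n: "n \<ge> 1"
    and hpos: "h > 0" and rpos: "r > 0" and Mpos: "M > 0"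
    and A1: "assumption_A1 m (h ^ (2 * m))"
    and K: "is_repr_kernel m (h ^ (2 * m)) K"
    and P: "is_P_op m (h ^ (2 * m)) P"
    and c0pos: "c0 > 0"
    and c0: "\<forall>e>0. packing_number e (G_class m h (c_K h K)) \<noteq> \<infinity> \<and>
               ln (real (the_enat (packing_number e (G_class m h (c_K h K)))))
                 \<le> c0 * h powr (- (2 * real m - 1) / (2 * real m)) * e powr (- 1 / real m)"
    and cond: "(c_K h K)\<^sup>2 * sqrt M * r * h powr (- 1 / 2) * A_fun m c0 (c_K h K) h 2 \<le> 1 / 2"
  shows "\<forall>f\<in>sobolev m. Jm m f f \<le> 1 \<longrightarrow>
     (\<exists>E\<in>sets (sample_space n).
        {\<omega> \<in> space (sample_space n).
           \<exists>fh. is_spline_est m (h ^ (2 * m)) n (\<lambda>i. fst (\<omega> i)) (\<lambda>i. f (fst (\<omega> i)) + snd (\<omega> i)) fh \<and>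
             snorm m (h ^ (2 * m))
               (\<lambda>x. fh x - f x - ((1 / real n) * (\<Sum>i<n. snd (\<omega> i) * K (fst (\<omega> i)) x) - P f x))
             \<ge> (c_K h K)\<^sup>2 * sqrt M * r * h powr (- 1 / 2) * A_fun m c0 (c_K h K) h 2 *
               (2 * h ^ m + c_K h K * (sqrt (2 * M) * r + (real n * h) powr (- 1 / 2)))}
        \<subseteq> E \<and>
        measure (sample_space n) E \<le> 2 * exp (- M * real n * h * r\<^sup>2))"
proof (intro ballI impI)
  fix f assume f: "f \<in> sobolev m" and J: "Jm m f f \<le> 1"
  define lam where "lam = h ^ (2 * m)"
  define cK where "cK = c_K h K"
  define A where "A = A_fun m c0 cK h 2"
  define \<kappa> where "\<kappa> = cK\<^sup>2 * sqrt M * r * h powr (- 1 / 2) * A"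
  define t where "t = M * real n * h * r\<^sup>2"
  \<comment> \<open>Twice the first noise term of \<open>\<delta>_n\<close>: large enough for the
    exponent \<open>4 * t\<close>, small enough for the final comparison.\<close>
  define w where "w = 2 * (cK * (sqrt (2 * M) * r))"
  define b where "b = cK / sqrt h"
  let ?S = "sample_space n"
  have lam: "lam > 0" using hpos by (simp add: lam_def)
  have sqrt_lam: "sqrt lam = h ^ m"
    using hpos by (simp add: lam_def power_mult power2_eq_square[symmetric] mult.commute[of 2])
  obtain I e where ex: "orthonormal_expansion (sobolev m) (T01 m lam) I e"
    and Kb: "\<And>x. x \<in> {0..1} \<Longrightarrow> K x x \<le> cK\<^sup>2 / h" and cK: "cK > 0"
    using kernel_sup_bound[OF A1 K m hpos] lam unfolding lam_def cK_def by metis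
  have b0: "b > 0" and b2: "b\<^sup>2 = cK\<^sup>2 / h"
    using cK hpos by (simp_all add: b_def power_divide)
  interpret orthonormal_expansion "sobolev m" "T01 m lam" I e by (rule ex)
  interpret spline_rkhs m lam I e K P b
    using m lam K P b0 Kb by unfold_locales (simp_all add: lam_def b2)
  interpret S: prob_space ?S
    unfolding sample_space_def by (intro prob_space_PiM prob_space_observation)
  have A32: "A \<ge> 32" unfolding A_def by (rule A_fun_ge[OF c0pos cK hpos])
  have hp: "h powr (- 1 / 2) = 1 / sqrt h"
    using hpos powr_minus_divide[of h "1 / 2"] by (simp add: powr_half_sqrt)
  have \<kappa>: "\<kappa> > 0" unfolding \<kappa>_def using cK Mpos rpos hpos A32 by (intro mult_pos_pos) auto
  have \<kappa>_half: "\<kappa> \<le> 1 / 2" using cond by (simp add: \<kappa>_def A_def cK_def)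
  have w: "w > 0" unfolding w_def using cK Mpos rpos by simp
  \<comment> \<open>The level \<open>\<kappa> / 4\<close> is at most \<open>1 / 8\<close>, so the
    remainder can be absorbed, and still large enough for \<open>A \<ge> 32\<close> to give the
    exponent \<open>4 * t\<close>.\<close>
  define E1 where "E1 = {\<omega> \<in> space ?S.
      \<exists>N. L2_set (\<lambda>p. \<Sum>j<n. tensor (fst (\<omega> j)) p - tensor_mean p) (square_index N) > n * (\<kappa> / 4)}"
  define E2 where "E2 = {\<omega> \<in> space ?S.
      \<exists>N. L2_set (\<lambda>\<nu>. \<Sum>j<n. snd (\<omega> j) * clip (e \<nu>) (fst (\<omega> j))) (I \<inter> {..N}) > n * w}"
  obtain E3 where E3_sub: "{\<omega> \<in> space ?S. \<not> (\<forall>i<n. fst (\<omega> i) \<in> {0..1})} \<subseteq> E3"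
    and "emeasure ?S E3 = 0" and E3_sets: "E3 \<in> sets ?S"
    by (rule AE_E[OF AE_sample_in_unit_interval[of n]])
  then have E3: "measure ?S E3 = 0" by (simp add: measure_def)
  define bad where "bad = {\<omega> \<in> space ?S.
           \<exists>fh. is_spline_est m lam n (\<lambda>i. fst (\<omega> i)) (\<lambda>i. f (fst (\<omega> i)) + snd (\<omega> i)) fh \<and>
             snorm m lam
               (\<lambda>x. fh x - f x - ((1 / real n) * (\<Sum>i<n. snd (\<omega> i) * K (fst (\<omega> i)) x) - P f x))
             \<ge> \<kappa> * (2 * h ^ m + cK * (sqrt (2 * M) * r + (real n * h) powr (- 1 / 2)))}"
  have sub: "bad \<subseteq> E1 \<union> E2 \<union> E3"
  proof (rule subsetI, rule ccontr)
    fix \<omega> assume \<omega>: "\<omega> \<in> bad" and out: "\<omega> \<notin> E1 \<union> E2 \<union> E3"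
    then obtain fh where sp: "\<omega> \<in> space ?S"
      and est: "is_spline_est m lam n (\<lambda>i. fst (\<omega> i)) (\<lambda>i. f (fst (\<omega> i)) + snd (\<omega> i)) fh"
      and large: "snorm m lam
               (\<lambda>x. fh x - f x - ((1 / real n) * (\<Sum>i<n. snd (\<omega> i) * K (fst (\<omega> i)) x) - P f x))
             \<ge> \<kappa> * (2 * h ^ m + cK * (sqrt (2 * M) * r + (real n * h) powr (- 1 / 2)))"
      unfolding bad_def by blast
    define R where "R = (\<lambda>x. fh x - f x - ((1 / real n) * (\<Sum>i<n. snd (\<omega> i) * K (fst (\<omega> i)) x) - P f x))"
    have X: "fst (\<omega> i) \<in> {0..1}" if "i < n" for i using out sp E3_sub that by blast
    have 1: "L2_set (\<lambda>p. \<Sum>j<n. tensor (fst (\<omega> j)) p - tensor_mean p) (square_index N) \<le> n * (\<kappa> / 4)" for N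
      using out sp unfolding E1_def by (auto simp: not_less)
    have 2: "L2_set (\<lambda>\<nu>. \<Sum>j<n. snd (\<omega> j) * clip (e \<nu>) (fst (\<omega> j))) (I \<inter> {..N}) \<le> n * w" for N
      using out sp unfolding E2_def by (auto simp: not_less)
    have "nrm R \<le> \<kappa> / 4 * (nrm R + (w + h ^ m))"
      using remainder_bound_off_events[OF n X f J est 1 2] unfolding R_def[symmetric] sqrt_lam .
    moreover have "\<kappa> / 4 * nrm R \<le> 1 / 8 * nrm R"
      using \<kappa>_half nrm_nonneg[of R] by (intro mult_right_mono) auto
    \<comment> \<open>The term \<open>nrm R / 8\<close> moves to the left-hand side, which costs the
      factor \<open>8 / 7\<close>.\<close>
    ultimately have "nrm R \<le> 8 / 7 * (\<kappa> / 4 * (w + h ^ m))"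
      unfolding distrib_left[of "\<kappa> / 4" "nrm R"] by linarith
    also have "\<dots> = \<kappa> * (2 / 7 * (w + h ^ m))" by simp
    also have "\<dots> < \<kappa> * (2 * h ^ m + cK * (sqrt (2 * M) * r + (real n * h) powr (- 1 / 2)))"
    proof (rule mult_strict_left_mono[OF _ \<kappa>])
      \<comment> \<open>Here \<open>p\<close> is half of \<open>w\<close>, \<open>q\<close> is
        \<open>h ^ m\<close>, and \<open>z\<close> is the term with
        \<open>(n * h) powr (- 1 / 2)\<close>. Strictness is needed because the excluded event has a
        non-strict inequality.\<close>
      have "2 / 7 * (2 * p + q) < 2 * q + (p + z)" if "0 < p" "0 < q" "0 \<le> z" for p q z :: real
        using that by simp
      moreover have "0 < h ^ m" "0 \<le> cK * (real n * h) powr (- 1 / 2)" using hpos cK by auto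
      ultimately show "2 / 7 * (w + h ^ m) < 2 * h ^ m + cK * (sqrt (2 * M) * r + (real n * h) powr (- 1 / 2))"
        using w unfolding w_def distrib_left[of cK] by simp
    qed
    finally show False
      using large snorm_le_T01[of m lam R] unfolding R_def[symmetric] nrm_def by linarith
  qed
  have t: "t > 0" using Mpos n hpos rpos by (simp add: t_def)
  have m1: "measure ?S E1 \<le> 2 * exp (- (4 * t))" and E1: "E1 \<in> sets ?S"
  proof -
    have y: "0 \<le> n * (\<kappa> / 4)" using \<kappa> by simp
    have \<kappa>2: "\<kappa>\<^sup>2 = (cK\<^sup>2)\<^sup>2 * M * r\<^sup>2 / h * A\<^sup>2"
      unfolding \<kappa>_def hp using Mpos hpos by (simp add: power_mult_distrib power_divide)
    have "(n * (\<kappa> / 4))\<^sup>2 / (4 * n * (2 * b\<^sup>2)\<^sup>2) = t * (A\<^sup>2 / 256)"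
      unfolding power_mult_distrib power_divide \<kappa>2 b2 t_def
      using cK hpos n by (simp add: field_simps power2_eq_square)
    moreover have "32\<^sup>2 \<le> A\<^sup>2" using A32 by (intro power_mono) auto
    then have "t * 4 \<le> t * (A\<^sup>2 / 256)" using t by (intro mult_left_mono) auto
    ultimately have "4 * t \<le> (n * (\<kappa> / 4))\<^sup>2 / (4 * n * (2 * b\<^sup>2)\<^sup>2)"
      by (simp only: mult.commute[of 4 t])
    then have "2 * exp (- ((n * (\<kappa> / 4))\<^sup>2 / (4 * n * (2 * b\<^sup>2)\<^sup>2))) \<le> 2 * exp (- (4 * t))" by simp
    with tensor_deviation_tail(2)[OF n y b0] show "measure ?S E1 \<le> 2 * exp (- (4 * t))"
      unfolding E1_def by (rule order_trans)
    show "E1 \<in> sets ?S" unfolding E1_def by (rule tensor_deviation_tail(1)[OF n y b0])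
  qed
  have m2: "measure ?S E2 \<le> 2 * exp (- (4 * t))" and E2: "E2 \<in> sets ?S"
  proof -
    have y: "0 \<le> n * w" using w by simp
    have "w\<^sup>2 = 8 * cK\<^sup>2 * M * r\<^sup>2"
      unfolding w_def using Mpos by (simp add: power_mult_distrib)
    then have "(n * w)\<^sup>2 / (4 * n * (b\<^sup>2 / 2)) = 4 * t"
      unfolding power_mult_distrib b2 t_def
      using cK hpos n by (simp add: field_simps power2_eq_square)
    with noise_tail(2)[OF n y b0] show "measure ?S E2 \<le> 2 * exp (- (4 * t))"
      unfolding E2_def by simp
    show "E2 \<in> sets ?S" unfolding E2_def by (rule noise_tail(1)[OF n y b0])
  qed
  have "\<exists>E\<in>sets ?S. bad \<subseteq> E \<and> measure ?S E \<le> 2 * exp (- t)"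
  \<comment> \<open>If the claimed bound is at least one, the whole space serves as the event.
    Otherwise \<open>exp (- t) \<le> 1 / 2\<close>, and three of the four factors in
    \<open>exp (- (4 * t))\<close> absorb the prefactor \<open>4\<close> of the union bound.\<close>
  proof (cases "2 * exp (- t) \<ge> 1")
    case True
    then show ?thesis
      by (intro bexI[of _ "space ?S"]) (auto simp: bad_def S.prob_space)
  next
    case False
    then have small: "exp (- t) \<le> 1 / 2" by simp
    have "measure ?S (E1 \<union> E2 \<union> E3) \<le> measure ?S E1 + measure ?S E2 + measure ?S E3"
      using measure_Un_le[of E1 ?S E2] measure_Un_le[of "E1 \<union> E2" ?S E3] E1 E2 E3_sets by simp
    also have "\<dots> \<le> 4 * exp (- (4 * t))" using m1 m2 E3 by simp
    also have "exp (- (4 * t)) = exp (- t) ^ 3 * exp (- t)"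
      by (simp add: exp_of_nat_mult[symmetric] exp_add[symmetric])
    also have "4 * (exp (- t) ^ 3 * exp (- t)) \<le> 4 * ((1 / 2) ^ 3 * exp (- t))"
      using small by (intro mult_left_mono mult_right_mono power_mono) auto
    also have "\<dots> \<le> 2 * exp (- t)" by (simp add: power3_eq_cube)
    finally show ?thesis using sub E1 E2 E3_sets by (intro bexI[of _ "E1 \<union> E2 \<union> E3"]) auto
  qed
  then show "\<exists>E\<in>sets (sample_space n).
        {\<omega> \<in> space (sample_space n).
           \<exists>fh. is_spline_est m (h ^ (2 * m)) n (\<lambda>i. fst (\<omega> i)) (\<lambda>i. f (fst (\<omega> i)) + snd (\<omega> i)) fh \<and>
             snorm m (h ^ (2 * m))
               (\<lambda>x. fh x - f x - ((1 / real n) * (\<Sum>i<n. snd (\<omega> i) * K (fst (\<omega> i)) x) - P f x))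
             \<ge> (c_K h K)\<^sup>2 * sqrt M * r * h powr (- 1 / 2) * A_fun m c0 (c_K h K) h 2 *
               (2 * h ^ m + c_K h K * (sqrt (2 * M) * r + (real n * h) powr (- 1 / 2)))}
        \<subseteq> E \<and>
        measure (sample_space n) E \<le> 2 * exp (- M * real n * h * r\<^sup>2)"
    unfolding bad_def t_def \<kappa>_def A_def cK_def lam_def by simp
qed

end
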